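(* Let $m\ge 1$, let $G$ be a finite subgroup of $\mathrm{GL}(m,\mathbb C)$ and let $L$ be a normal subgroup of $G$ such that $G/L$ is cyclic. If every irreducible complex character of $L$ is extendible to $G$, then the McKay quiver $Q_G$ of $G$ is a regular covering of the McKay quiver $Q_L$ of $L$ with the group $G/L$; that is, there is a regular covering map $\pi:Q_G\to Q_L$ with the group $G/L$.
   Context: McKay quiver: for a finite subgroup $H$ of $\mathrm{GL}(m,\mathbb C)=\mathrm{GL}(V)$, $V=\mathbb C^m$, let $S_1,\dots,S_n$ be a complete set of representatives of the isomorphism classes of irreducible complex representations of $H$, and write $V\otimes S_i\cong\bigoplus_j a_{i,j}S_j$, where $a_{i,j}S_j$ denotes a direct sum of $a_{i,j}$ copies of $S_j$. The McKay quiver $Q_H=(Q_{H,0},Q_{H,1})$ has as vertices the isomorphism classes of irreducible representations (indexed by $1,\dots,n$), and $a_{i,j}$ arrows from $i$ to $j$. Here both $Q_G$ and $Q_L$ are formed with $V=\mathbb C^m$, viewed by restriction as a representation of $L$. Extendible: an irreducible character $\chi$ of $L$ is extendible (to $G$) if there is an irreducible character $\chi'$ of $G$ with $\chi'|_L=\chi$. Regular covering: for a vertex $i$ of a quiver $Q$, $i^-$ denotes the set of arrows ending at $i$ and $i^+$ the set of arrows starting at $i$. For a group $\Gamma$, a map of quivers $\pi:Q\to Q'$ is a regular covering map with the group $\Gamma$ if for every vertex $j\in Q'_0$ the group $\Gamma$ acts transitively and freely on $\pi^{-1}(j)$, and for each vertex $i\in Q_0$ the induced maps $i^+\to\pi(i)^+$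 and $i^-\to\pi(i)^-$ are both bijective. (This is the usual notion of a regular covering map of oriented graphs with automorphism group $\Gamma$.) *)

theory Defs
  imports
    "HOL-Algebra.Algebra"
    "Jordan_Normal_Form.VS_Connect"
    "Graph_Theory.Digraph"
begin

section \<open>Matrix groups and representations\<close>

definition GL :: "nat \<Rightarrow> complex mat monoid" where
  "GL m = units_of (ring_mat TYPE(complex) m ())"

abbreviation GL_sub :: "nat \<Rightarrow> complex mat set \<Rightarrow> complex mat monoid" where
  "GL_sub m H \<equiv> (GL m)\<lparr>carrier := H\<rparr>"

text \<open>Finite-dimensional complex representations are given in coordinates: a pair
  \<open>(d, \<rho>)\<close> stands for the homomorphism \<open>\<rho>\<close> into \<open>GL(d, \<complex>)\<close>, acting on
  column vectors. The values of \<open>\<rho>\<close> outside the carrier are irrelevant.\<close>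

type_synonym 'g rep = "nat \<times> ('g \<Rightarrow> complex mat)"

definition is_rep :: "('g, 'b) monoid_scheme \<Rightarrow> 'g rep \<Rightarrow> bool" where
  "is_rep K R \<longleftrightarrow> snd R \<in> hom K (GL (fst R))"

definition irreducible_rep :: "('g, 'b) monoid_scheme \<Rightarrow> 'g rep \<Rightarrow> bool" where
  "irreducible_rep K R \<longleftrightarrow> is_rep K R \<and> fst R > 0 \<and>
     (\<forall>W. VectorSpace.subspace class_ring W (module_vec TYPE(complex) (fst R)) \<and>
          (\<forall>g\<in>carrier K. \<forall>v\<in>W. snd R g *\<^sub>v v \<in> W)
        \<longrightarrow> W = {0\<^sub>v (fst R)} \<or> W = carrier_vec (fst R))"

definition rep_iso :: "('g, 'b) monoid_scheme \<Rightarrow> 'g rep \<Rightarrow> 'g rep \<Rightarrow> bool" where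
  "rep_iso K R S \<longleftrightarrow> fst R = fst S \<and>
     (\<exists>P\<in>carrier (GL (fst R)). \<forall>g\<in>carrier K. P * snd R g = snd S g * P)"

definition kronecker :: "complex mat \<Rightarrow> complex mat \<Rightarrow> complex mat" where
  "kronecker A B = mat (dim_row A * dim_row B) (dim_col A * dim_col B)
     (\<lambda>(i, j). A $$ (i div dim_row B, j div dim_col B) * B $$ (i mod dim_row B, j mod dim_col B))"

definition tensor_rep :: "'g rep \<Rightarrow> 'g rep \<Rightarrow> 'g rep" where
  "tensor_rep R S = (fst R * fst S, \<lambda>g. kronecker (snd R g) (snd S g))"

definition direct_sum_rep :: "'g rep list \<Rightarrow> 'g rep" where
  "direct_sum_rep Rs = (sum_list (map fst Rs), \<lambda>g. diag_block_mat (map (\<lambda>R. snd R g) Rs))"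

section \<open>Characters\<close>

definition mat_trace :: "complex mat \<Rightarrow> complex" where
  "mat_trace A = (\<Sum>i<dim_row A. A $$ (i, i))"

definition irr_chars :: "('g, 'b) monoid_scheme \<Rightarrow> ('g \<Rightarrow> complex) set" where
  "irr_chars K = {restrict (\<lambda>g. mat_trace (snd R g)) (carrier K) | R. irreducible_rep K R}"

definition extendible :: "('g, 'b) monoid_scheme \<Rightarrow> 'g set \<Rightarrow> ('g \<Rightarrow> complex) \<Rightarrow> bool" where
  "extendible K L \<chi> \<longleftrightarrow> (\<exists>\<chi>'\<in>irr_chars K. restrict \<chi>' L = \<chi>)"

section \<open>The McKay quiver\<close>

definition irr_classes :: "('g, 'b) monoid_scheme \<Rightarrow> 'g rep set set" where
  "irr_classes K = {R. irreducible_rep K R} //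
     {(R, S). irreducible_rep K R \<and> irreducible_rep K S \<and> rep_iso K R S}"

text \<open>The chosen representative \<open>S\<^sub>i\<close> of an isomorphism class.\<close>

definition class_rep :: "'g rep set \<Rightarrow> 'g rep" where
  "class_rep C = (SOME R. R \<in> C)"

text \<open>\<open>irr_mult K R C\<close> is the coefficient of the class \<open>C\<close> in the decomposition of \<open>R\<close>
  as a direct sum of the chosen representatives. The list \<open>Cs\<close> enumerates the
  classes of the summands, each class repeated according to its number of copies. The
  number is well defined by complete reducibility and Krull--Schmidt when \<open>R\<close> is a
  representation of a finite group.\<close>

definition irr_mult :: "('g, 'b) monoid_scheme \<Rightarrow> 'g rep \<Rightarrow> 'g rep set \<Rightarrow> nat" where
  "irr_mult K R C = (THE k. \<exists>Cs. set Cs \<subseteq> irr_classes K \<and>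
     rep_iso K R (direct_sum_rep (map class_rep Cs)) \<and> k = count_list Cs C)"

text \<open>The arrows from \<open>C\<close> to \<open>D\<close> are the triples \<open>(C, D, k)\<close> with \<open>k\<close> below the
  multiplicity of \<open>D\<close> in \<open>V \<otimes> C\<close>, where \<open>V\<close> is the defining representation
  \<open>(m, \<lambda>g. g)\<close> of the matrix group \<open>H\<close>.\<close>

type_synonym mckay_vertex = "complex mat rep set"

definition mckay_quiver ::
  "nat \<Rightarrow> complex mat set \<Rightarrow> (mckay_vertex, mckay_vertex \<times> mckay_vertex \<times> nat) pre_digraph" where
  "mckay_quiver m H = \<lparr>
     verts = irr_classes (GL_sub m H),
     arcs = {(C, D, k). C \<in> irr_classes (GL_sub m H) \<and> D \<in> irr_classes (GL_sub m H) \<and>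
               k < irr_mult (GL_sub m H) (tensor_rep (m, \<lambda>g. g) (class_rep C)) D},
     tail = (\<lambda>(C, D, k). C),
     head = (\<lambda>(C, D, k). D)\<rparr>"

section \<open>Regular coverings of quivers\<close>

definition quiver_map ::
  "('v, 'a) pre_digraph \<Rightarrow> ('w, 'b) pre_digraph \<Rightarrow> ('v \<Rightarrow> 'w) \<Rightarrow> ('a \<Rightarrow> 'b) \<Rightarrow> bool" where
  "quiver_map Q Q' fv fa \<longleftrightarrow>
     fv ` verts Q \<subseteq> verts Q' \<and> fa ` arcs Q \<subseteq> arcs Q' \<and>
     (\<forall>e\<in>arcs Q. tail Q' (fa e) = fv (tail Q e) \<and> head Q' (fa e) = fv (head Q e))"

text \<open>The group acts by automorphisms of the quiver over the base (deck transformations).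
  A transitive action is understood to be on a nonempty set, so every fibre is nonempty.\<close>

definition regular_covering_map ::
  "('g, 'c) monoid_scheme \<Rightarrow> ('v, 'a) pre_digraph \<Rightarrow> ('w, 'b) pre_digraph \<Rightarrow>
   ('v \<Rightarrow> 'w) \<Rightarrow> ('a \<Rightarrow> 'b) \<Rightarrow> bool" where
  "regular_covering_map \<Gamma> Q Q' \<pi>v \<pi>a \<longleftrightarrow>
     quiver_map Q Q' \<pi>v \<pi>a \<and>
     (\<exists>\<phi>v \<phi>a. group_action \<Gamma> (verts Q) \<phi>v \<and> group_action \<Gamma> (arcs Q) \<phi>a \<and>
        (\<forall>\<gamma>\<in>carrier \<Gamma>. quiver_map Q Q (\<phi>v \<gamma>) (\<phi>a \<gamma>) \<and>
           (\<forall>i\<in>verts Q. \<pi>v (\<phi>v \<gamma> i) = \<pi>v i) \<and> (\<forall>e\<in>arcs Q. \<pi>a (\<phi>a \<gamma> e) = \<pi>a e)) \<and>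
        (\<forall>j\<in>verts Q'. let F = {i \<in> verts Q. \<pi>v i = j} in
           F \<noteq> {} \<and>
           (\<forall>x\<in>F. \<forall>y\<in>F. \<exists>\<gamma>\<in>carrier \<Gamma>. \<phi>v \<gamma> x = y) \<and>
           (\<forall>x\<in>F. stabilizer \<Gamma> \<phi>v x = {\<one>\<^bsub>\<Gamma>\<^esub>}))) \<and>
     (\<forall>i\<in>verts Q. bij_betw \<pi>a (out_arcs Q i) (out_arcs Q' (\<pi>v i)) \<and>
                   bij_betw \<pi>a (in_arcs Q i) (in_arcs Q' (\<pi>v i)))"

end

theory Submission
  imports Defs "Jordan_Normal_Form.Spectral_Radius"
begin

text \<open>Identify the cyclic group \<open>G/L\<close> with its group of linear characters. It acts on the
  irreducible representations of \<open>G\<close> by twisting, and the sum of the twists of \<open>R\<close> plays the role of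
  the representation induced from the restriction of \<open>R\<close> to \<open>L\<close>. Since the irreducible characters
  of \<open>L\<close> extend, every irreducible representation of \<open>G\<close> is a twist of an extension. Hence
  restriction to \<open>L\<close> preserves irreducibility, and its fibres are free orbits of twists. Frobenius
  reciprocity shows that the multiplicity of \<open>D|\<^sub>L\<close> in \<open>V \<otimes> C|\<^sub>L\<close> is the sum of
  the multiplicities of the twists of \<open>D\<close> in \<open>V \<otimes> C\<close>. As multiplicities are unchanged when
  \<open>C\<close> and \<open>D\<close> are twisted simultaneously, the arrows can be matched equivariantly.\<close>

section \<open>Subspaces as ranges of matrices\<close>

text \<open>The arrows are defined through decompositions and a definite description, so every claim
  about them has to become a claim about numbers. Characters achieve this: a multiplicity equals a
  value of the character pairing, and the two facts needed about arrows become identities of finite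
  sums. This is also why a sum of twists can stand for an induced representation: only its character
  matters, and no induced matrices have to be written down. The group that acts by twisting is
  naturally the dual of the quotient, whereas the covering asks for an action of the quotient
  itself. For a finite cyclic group the two are isomorphic, though not canonically: a generator and
  a primitive root of unity have to be chosen. Parallel arrows are merely numbered, so no bijection
  between the arrows above and below is canonical. One is chosen at a single tail in each fibre and
  transported by the action. This settles outgoing arrows; for incoming arrows, freeness on the
  vertices recovers the tail.\<close>

lemma index_mult_sum:
  assumes "A \<in> carrier_mat n k" "B \<in> carrier_mat k m" "i < n" "j < m"
  shows "(A * B) $$ (i, j) = (\<Sum>l<k. A $$ (i, l) * B $$ (l, j))"
  using assms by (auto simp: scalar_prod_def atLeast0LessThan intro!: sum.cong)

lemma index_mult_vec_sum:
  assumes "A \<in> carrier_mat n k" "v \<in> carrier_vec k" "i < n"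
  shows "(A *\<^sub>v v) $ i = (\<Sum>l<k. A $$ (i, l) * v $ l)"
  using assms by (auto simp: scalar_prod_def atLeast0LessThan intro!: sum.cong)

text \<open>If \<open>k\<close> exceeded \<open>d\<close>, padding \<open>A\<close> with zero rows
  and \<open>B\<close> with zero columns would give square matrices with the same product. For
  square matrices a left inverse is also a right inverse, yet row \<open>d\<close> of the padded
  \<open>A\<close> vanishes. This inequality does the work of dimension theory below.\<close>

lemma mult_left_inverse_le:
  fixes A B :: "complex mat"
  assumes A: "A \<in> carrier_mat d k" and B: "B \<in> carrier_mat k d" and BA: "B * A = 1\<^sub>m k"
  shows "k \<le> d"
proof (rule ccontr)
  assume "\<not> k \<le> d"
  then have dk: "d < k" by simp
  define A' where "A' = mat k k (\<lambda>(i, j). if i < d then A $$ (i, j) else 0)"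
  define B' where "B' = mat k k (\<lambda>(i, j). if j < d then B $$ (i, j) else 0)"
  have c: "A' \<in> carrier_mat k k" "B' \<in> carrier_mat k k"
    by (auto simp: A'_def B'_def)
  have "B' * A' = 1\<^sub>m k"
  proof (rule eq_matI)
    fix i j assume ij: "i < dim_row (1\<^sub>m k :: complex mat)" "j < dim_col (1\<^sub>m k :: complex mat)"
    have "(B' * A') $$ (i, j) = (\<Sum>l<k. B' $$ (i, l) * A' $$ (l, j))"
      using ij by (intro index_mult_sum[OF c(2,1)]) auto
    also have "\<dots> = (\<Sum>l<d. B $$ (i, l) * A $$ (l, j))"
      using ij dk by (intro sum.mono_neutral_cong_right) (auto simp: A'_def B'_def)
    also have "\<dots> = (B * A) $$ (i, j)"
      using ij by (intro index_mult_sum[OF B A, symmetric]) auto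
    finally show "(B' * A') $$ (i, j) = 1\<^sub>m k $$ (i, j)" using BA by simp
  qed (use c in auto)
  then have "A' * B' = 1\<^sub>m k" using mat_mult_left_right_inverse c by blast
  moreover have "(A' * B') $$ (d, d) = (\<Sum>l<k. A' $$ (d, l) * B' $$ (l, d))"
    using dk by (intro index_mult_sum[OF c])
  moreover have "\<dots> = 0" using dk by (intro sum.neutral) (auto simp: A'_def)
  ultimately show False using dk by simp
qed

text \<open>A pair \<open>A\<close>, \<open>B\<close> with \<open>B * A = 1\<close> serves as a basis of \<open>W\<close> together with a coordinate
  projection; a pair with the maximal number of columns exhausts \<open>W\<close>.\<close>

lemma subspace_as_range:
  fixes W :: "complex vec set"
  assumes W: "W \<subseteq> carrier_vec d" and W0: "0\<^sub>v d \<in> W"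
    and Wadd: "\<And>v w. v \<in> W \<Longrightarrow> w \<in> W \<Longrightarrow> v + w \<in> W"
    and Wsmult: "\<And>c v. v \<in> W \<Longrightarrow> c \<cdot>\<^sub>v v \<in> W"
  obtains k A B where "A \<in> carrier_mat d k" "B \<in> carrier_mat k d" "B * A = 1\<^sub>m k"
    "W = (\<lambda>x. A *\<^sub>v x) ` carrier_vec k"
proof -
  define P where "P k \<longleftrightarrow> (\<exists>A B. A \<in> carrier_mat d k \<and> B \<in> carrier_mat k d \<and> B * A = 1\<^sub>m k \<and>
    (\<forall>x\<in>carrier_vec k. A *\<^sub>v x \<in> W))" for k
  have bound: "\<forall>k. P k \<longrightarrow> k \<le> d" using mult_left_inverse_le unfolding P_def by blast
  have "0\<^sub>m d 0 *\<^sub>v x = 0\<^sub>v d" if "x \<in> carrier_vec 0" for x :: "complex vec"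
    using that by (intro eq_vecI) (auto simp: scalar_prod_def)
  then have "P 0" unfolding P_def using W0
    by (intro exI[of _ "0\<^sub>m d 0"] exI[of _ "0\<^sub>m 0 d"]) auto
  then obtain k where k: "P k" and max: "\<And>n. P n \<Longrightarrow> n \<le> k"
    using GreatestI_nat[of P 0 d] Greatest_le_nat[of P _ d] bound by blast
  obtain A B where A: "A \<in> carrier_mat d k" and B: "B \<in> carrier_mat k d" and BA: "B * A = 1\<^sub>m k"
    and AW: "\<And>x. x \<in> carrier_vec k \<Longrightarrow> A *\<^sub>v x \<in> W" using k unfolding P_def by blast
  have "w = A *\<^sub>v (B *\<^sub>v w)" if w: "w \<in> W" for w
  proof (rule ccontr)
    assume ne: "w \<noteq> A *\<^sub>v (B *\<^sub>v w)"
    have wc: "w \<in> carrier_vec d" using w W by auto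
    \<comment> \<open>The component of \<open>w\<close> missed by the projection
      \<open>A * B\<close>. It lies in \<open>W\<close>, is killed by \<open>B\<close> and is
      nonzero, so it can be adjoined to \<open>A\<close> as a further column.\<close>
    define v where "v = w - A *\<^sub>v (B *\<^sub>v w)"
    have vc: "v \<in> carrier_vec d" using wc A B unfolding v_def by auto
    have "v = w + (-1) \<cdot>\<^sub>v (A *\<^sub>v (B *\<^sub>v w))"
      using wc A B unfolding v_def by (intro eq_vecI) auto
    moreover have "A *\<^sub>v (B *\<^sub>v w) \<in> W" using B by (intro AW carrier_vecI) auto
    ultimately have vW: "v \<in> W" using w Wadd Wsmult by metis
    have "B *\<^sub>v v = B *\<^sub>v w - B *\<^sub>v (A *\<^sub>v (B *\<^sub>v w))"
      unfolding v_def using A B wc by (intro mult_minus_distrib_mat_vec[of _ k d]) auto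
    also have "B *\<^sub>v (A *\<^sub>v (B *\<^sub>v w)) = (B * A) *\<^sub>v (B *\<^sub>v w)"
      using A B wc by (intro assoc_mult_mat_vec[symmetric, of _ k d _ k]) auto
    also have "\<dots> = B *\<^sub>v w" using BA B wc by simp
    finally have Bv: "B *\<^sub>v v = 0\<^sub>v k" using B wc by auto
    obtain p where p: "p < d" "v $ p \<noteq> 0"
    proof (rule ccontr)
      assume "\<not> thesis"
      then have z: "\<And>p. p < d \<Longrightarrow> v $ p = 0" using that by blast
      have "w = A *\<^sub>v (B *\<^sub>v w)"
      proof (rule eq_vecI)
        fix i assume "i < dim_vec (A *\<^sub>v (B *\<^sub>v w))"
        then show "w $ i = (A *\<^sub>v (B *\<^sub>v w)) $ i" using z[of i] wc A B unfolding v_def by auto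
      qed (use wc A in auto)
      then show False using ne by blast
    qed
    \<comment> \<open>The complementary projection kills the columns of \<open>A\<close> and fixes
      \<open>v\<close>. Its row \<open>p\<close>, divided by the nonzero entry \<open>v $ p\<close>,
      is therefore a functional that vanishes on the old columns and equals 1 on the new one:
      exactly the row that \<open>B\<close> needs.\<close>
    define M where "M = 1\<^sub>m d - A * B"
    have M: "M \<in> carrier_mat d d" using A B unfolding M_def by auto
    have "M * A = 1\<^sub>m d * A - A * B * A"
      unfolding M_def using A B by (intro minus_mult_distrib_mat[of _ d d]) auto
    also have "A * B * A = A" using A B BA by (simp add: assoc_mult_mat[of _ d k _ d _ k])
    finally have MA: "M * A = 0\<^sub>m d k" using A by auto
    have "M *\<^sub>v v = 1\<^sub>m d *\<^sub>v v - (A * B) *\<^sub>v v"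
      unfolding M_def using A B vc by (intro minus_mult_distrib_mat_vec[of _ d d]) auto
    also have "(A * B) *\<^sub>v v = A *\<^sub>v (B *\<^sub>v v)"
      using A B vc by (intro assoc_mult_mat_vec[of _ d k _ d]) auto
    also have "\<dots> = 0\<^sub>v d" using A unfolding Bv by (intro eq_vecI) auto
    finally have Mv: "M *\<^sub>v v = v" using vc by auto
    define A' where "A' = mat d (Suc k) (\<lambda>(i, j). if j < k then A $$ (i, j) else v $ i)"
    define B' where "B' = mat (Suc k) d (\<lambda>(i, j). if i < k then B $$ (i, j) else M $$ (p, j) / v $ p)"
    have c: "A' \<in> carrier_mat d (Suc k)" "B' \<in> carrier_mat (Suc k) d"
      by (auto simp: A'_def B'_def)
    have "B' * A' = 1\<^sub>m (Suc k)"
    proof (rule eq_matI)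
      fix i j assume "i < dim_row (1\<^sub>m (Suc k) :: complex mat)" "j < dim_col (1\<^sub>m (Suc k) :: complex mat)"
      then have ij: "i < Suc k" "j < Suc k" by auto
      have "(B' * A') $$ (i, j) = (\<Sum>l<d. B' $$ (i, l) * A' $$ (l, j))"
        using ij by (intro index_mult_sum[OF c(2,1)])
      also have "\<dots> = (if i < k then (if j < k then (B * A) $$ (i, j) else (B *\<^sub>v v) $ i)
          else (if j < k then (M * A) $$ (p, j) / v $ p else (M *\<^sub>v v) $ p / v $ p))"
        using ij A B M vc p
        by (auto simp: A'_def B'_def index_mult_sum index_mult_vec_sum sum_divide_distrib
            simp del: index_mult_mat index_mult_mat_vec)
      also have "\<dots> = 1\<^sub>m (Suc k) $$ (i, j)"
        using ij p by (auto simp: BA Bv MA Mv)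
      finally show "(B' * A') $$ (i, j) = 1\<^sub>m (Suc k) $$ (i, j)" .
    qed (use c in auto)
    moreover have "A' *\<^sub>v x \<in> W" if x: "x \<in> carrier_vec (Suc k)" for x
    proof -
      have "A' *\<^sub>v x = A *\<^sub>v (vec k (\<lambda>j. x $ j)) + (x $ k) \<cdot>\<^sub>v v"
      proof (rule eq_vecI)
        fix i assume "i < dim_vec (A *\<^sub>v (vec k (\<lambda>j. x $ j)) + (x $ k) \<cdot>\<^sub>v v)"
        then have i: "i < d" using vc by auto
        show "(A' *\<^sub>v x) $ i = (A *\<^sub>v (vec k (\<lambda>j. x $ j)) + (x $ k) \<cdot>\<^sub>v v) $ i"
          using i A vc by (simp add: index_mult_vec_sum[OF c(1) x] index_mult_vec_sum[OF A]
              del: index_mult_mat_vec)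
            (simp add: A'_def)
      qed (use c A vc in auto)
      then show ?thesis using AW vW Wadd Wsmult by simp
    qed
    ultimately have "P (Suc k)" using c unfolding P_def by blast
    then show False using max by fastforce
  qed
  moreover have "B *\<^sub>v w \<in> carrier_vec k" for w using B by (intro carrier_vecI) auto
  ultimately have "W = (\<lambda>x. A *\<^sub>v x) ` carrier_vec k" using AW by blast
  then show thesis using that A B BA by blast
qed

section \<open>Representations and intertwiners\<close>

lemma mult_assoc_dim:
  "dim_col A = dim_row B \<Longrightarrow> dim_col B = dim_row C \<Longrightarrow>
    (A :: complex mat) * B * C = A * (B * C)"
  by (rule assoc_mult_mat[of _ "dim_row A" "dim_row B" _ "dim_row C" _ "dim_col C"]) auto

lemma mult_vec_assoc_dim:
  "dim_col A = dim_row B \<Longrightarrow> dim_col B = dim_vec v \<Longrightarrow>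
    (A :: complex mat) * B *\<^sub>v v = A *\<^sub>v (B *\<^sub>v v)"
  by (rule assoc_mult_mat_vec[of _ "dim_row A" "dim_row B" _ "dim_vec v"]) (metis carrier_matI carrier_vecI)+

lemma eq_mat_mult_vecI:
  fixes A B :: "complex mat"
  assumes A: "A \<in> carrier_mat n k" and B: "B \<in> carrier_mat n k"
    and eq: "\<And>x. x \<in> carrier_vec k \<Longrightarrow> A *\<^sub>v x = B *\<^sub>v x"
  shows "A = B"
proof (rule eq_matI)
  fix i j assume "i < dim_row B" "j < dim_col B"
  then have ij: "i < n" "j < k" using B by auto
  have "M $$ (i, j) = (M *\<^sub>v unit_vec k j) $ i" if "M \<in> carrier_mat n k" for M :: "complex mat"
    using that ij by (simp add: scalar_prod_right_unit)
  then show "A $$ (i, j) = B $$ (i, j)" using eq[of "unit_vec k j"] A B by simp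
qed (use A B in auto)

lemma subspace_module_vec_iff:
  "VectorSpace.subspace class_ring W (module_vec TYPE(complex) d) \<longleftrightarrow>
    W \<subseteq> carrier_vec d \<and> 0\<^sub>v d \<in> W \<and> (\<forall>v\<in>W. \<forall>w\<in>W. v + w \<in> W) \<and> (\<forall>c. \<forall>v\<in>W. c \<cdot>\<^sub>v v \<in> W)"
proof -
  interpret vec_space "TYPE(complex)" d .
  show ?thesis
    unfolding VectorSpace.subspace_def submodule_def
    using vec_vs vec_module by (auto simp: module_vec_simps)
qed

lemma mult_GL [simp]: "A \<otimes>\<^bsub>GL d\<^esub> B = A * B"
  and one_GL [simp]: "\<one>\<^bsub>GL d\<^esub> = 1\<^sub>m d"
  by (auto simp: GL_def units_of_def ring_mat_simps)

lemma carrier_GL_iff: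
  "A \<in> carrier (GL d) \<longleftrightarrow>
    A \<in> carrier_mat d d \<and> (\<exists>B\<in>carrier_mat d d. B * A = 1\<^sub>m d \<and> A * B = 1\<^sub>m d)"
  by (simp add: GL_def units_of_def Units_def ring_mat_simps)

lemma carrier_GLI:
  "A \<in> carrier_mat d d \<Longrightarrow> B \<in> carrier_mat d d \<Longrightarrow> B * A = 1\<^sub>m d \<Longrightarrow> A * B = 1\<^sub>m d \<Longrightarrow>
    A \<in> carrier (GL d)"
  unfolding carrier_GL_iff by blast

lemma group_GL: "group (GL d)"
proof -
  interpret ring "ring_mat TYPE(complex) d ()" by (rule ring_mat)
  show ?thesis unfolding GL_def by (rule units_group)
qed

locale fin_group = group K for K :: "('g, 'b) monoid_scheme" (structure) +
  assumes finite_carrier: "finite (carrier K)"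

definition intertwines :: "('g, 'b) monoid_scheme \<Rightarrow> 'g rep \<Rightarrow> 'g rep \<Rightarrow> complex mat \<Rightarrow> bool" where
  "intertwines K R S T \<longleftrightarrow> T \<in> carrier_mat (fst S) (fst R) \<and>
     (\<forall>g\<in>carrier K. T * snd R g = snd S g * T)"

text \<open>Invertibility of the values comes from multiplicativity and the value at the unit: the
  value at the inverse element is the inverse matrix.\<close>

lemma (in group) is_rep_iff:
  "is_rep G R \<longleftrightarrow> (\<forall>g\<in>carrier G. snd R g \<in> carrier_mat (fst R) (fst R)) \<and>
     (\<forall>g\<in>carrier G. \<forall>h\<in>carrier G. snd R (g \<otimes> h) = snd R g * snd R h) \<and>
     snd R \<one> = 1\<^sub>m (fst R)" (is "_ \<longleftrightarrow> ?r")
proof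
  assume "is_rep G R"
  then have h: "snd R \<in> hom G (GL (fst R))" by (simp add: is_rep_def)
  then have "snd R \<one> = 1\<^sub>m (fst R)" using hom_one[OF h is_group group_GL] by simp
  then show ?r using h by (auto simp: hom_def carrier_GL_iff Pi_iff)
next
  assume r: ?r
  have "snd R g \<in> carrier (GL (fst R))" if g: "g \<in> carrier G" for g
    unfolding carrier_GL_iff
    using r g by (auto intro!: bexI[of _ "snd R (inv g)"] simp flip: r[THEN conjunct2, THEN conjunct1, rule_format])
  then show "is_rep G R" using r by (auto simp: is_rep_def hom_def)
qed

context group
begin

lemma rep_carrier: "is_rep G R \<Longrightarrow> g \<in> carrier G \<Longrightarrow> snd R g \<in> carrier_mat (fst R) (fst R)"
  by (simp add: is_rep_iff)

lemma rep_dim: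
  assumes "is_rep G R" "g \<in> carrier G"
  shows "dim_row (snd R g) = fst R" "dim_col (snd R g) = fst R"
  using rep_carrier[OF assms] by auto

lemma rep_mult:
  "is_rep G R \<Longrightarrow> g \<in> carrier G \<Longrightarrow> h \<in> carrier G \<Longrightarrow> snd R (g \<otimes> h) = snd R g * snd R h"
  by (simp add: is_rep_iff)

lemma rep_one: "is_rep G R \<Longrightarrow> snd R \<one> = 1\<^sub>m (fst R)"
  by (simp add: is_rep_iff)

lemma rep_inv:
  assumes "is_rep G R" "g \<in> carrier G"
  shows "snd R (inv g) * snd R g = 1\<^sub>m (fst R)" "snd R g * snd R (inv g) = 1\<^sub>m (fst R)"
  using assms by (simp_all add: rep_one flip: rep_mult)

end

subsection \<open>Averaging\<close>

text \<open>The size is an explicit argument because the matrix type does not determine it, so an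
  empty sum would otherwise have no definite shape.\<close>

definition msum :: "nat \<Rightarrow> nat \<Rightarrow> ('a \<Rightarrow> complex mat) \<Rightarrow> 'a set \<Rightarrow> complex mat" where
  "msum r c F I = mat r c (\<lambda>(i, j). \<Sum>x\<in>I. F x $$ (i, j))"

lemma msum_carrier [simp]: "msum r c F I \<in> carrier_mat r c"
  and dim_msum [simp]: "dim_row (msum r c F I) = r" "dim_col (msum r c F I) = c"
  by (auto simp: msum_def)

lemma msum_cong:
  "(\<And>x. x \<in> I \<Longrightarrow> F x = F' x) \<Longrightarrow> msum r c F I = msum r c F' I"
  unfolding msum_def by (intro cong_mat) auto

lemma mult_msum:
  assumes A: "A \<in> carrier_mat n r" and F: "\<And>x. x \<in> I \<Longrightarrow> F x \<in> carrier_mat r c"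
  shows "A * msum r c F I = msum n c (\<lambda>x. A * F x) I"
proof (rule eq_matI)
  fix i j assume "i < dim_row (msum n c (\<lambda>x. A * F x) I)" "j < dim_col (msum n c (\<lambda>x. A * F x) I)"
  then have ij: "i < n" "j < c" by auto
  have "(A * msum r c F I) $$ (i, j) = (\<Sum>l<r. A $$ (i, l) * msum r c F I $$ (l, j))"
    using ij by (intro index_mult_sum[OF A]) auto
  also have "\<dots> = (\<Sum>l<r. \<Sum>x\<in>I. A $$ (i, l) * F x $$ (l, j))"
    using ij by (simp add: msum_def sum_distrib_left)
  also have "\<dots> = (\<Sum>x\<in>I. \<Sum>l<r. A $$ (i, l) * F x $$ (l, j))"
    by (rule sum.swap)
  also have "\<dots> = (\<Sum>x\<in>I. (A * F x) $$ (i, j))"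
    using ij by (intro sum.cong refl index_mult_sum[OF A F, symmetric]) auto
  finally show "(A * msum r c F I) $$ (i, j) = msum n c (\<lambda>x. A * F x) I $$ (i, j)"
    using ij by (simp add: msum_def)
qed (use A in auto)

lemma msum_mult:
  assumes A: "A \<in> carrier_mat c n" and F: "\<And>x. x \<in> I \<Longrightarrow> F x \<in> carrier_mat r c"
  shows "msum r c F I * A = msum r n (\<lambda>x. F x * A) I"
proof (rule eq_matI)
  fix i j assume "i < dim_row (msum r n (\<lambda>x. F x * A) I)" "j < dim_col (msum r n (\<lambda>x. F x * A) I)"
  then have ij: "i < r" "j < n" by auto
  have "(msum r c F I * A) $$ (i, j) = (\<Sum>l<c. msum r c F I $$ (i, l) * A $$ (l, j))"
    using ij by (intro index_mult_sum[OF _ A]) auto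
  also have "\<dots> = (\<Sum>l<c. \<Sum>x\<in>I. F x $$ (i, l) * A $$ (l, j))"
    using ij by (simp add: msum_def sum_distrib_right)
  also have "\<dots> = (\<Sum>x\<in>I. \<Sum>l<c. F x $$ (i, l) * A $$ (l, j))"
    by (rule sum.swap)
  also have "\<dots> = (\<Sum>x\<in>I. (F x * A) $$ (i, j))"
    using ij by (intro sum.cong refl index_mult_sum[OF F A, symmetric]) auto
  finally show "(msum r c F I * A) $$ (i, j) = msum r n (\<lambda>x. F x * A) I $$ (i, j)"
    using ij by (simp add: msum_def)
qed (use A in auto)

text \<open>Not divided by the group order; the factor is either removed by the user or cancels
  against the denominator of \<open>char_ip\<close>.\<close>

definition average ::
  "('g, 'b) monoid_scheme \<Rightarrow> 'g rep \<Rightarrow> 'g rep \<Rightarrow> complex mat \<Rightarrow> complex mat" where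
  "average K R S Y = msum (fst S) (fst R) (\<lambda>g. snd S g * Y * snd R (m_inv K g)) (carrier K)"

lemma (in group) bij_betw_left_mult:
  "h \<in> carrier G \<Longrightarrow> bij_betw (\<lambda>g. h \<otimes> g) (carrier G) (carrier G)"
  by (rule bij_betw_byWitness[of _ "\<lambda>g. inv h \<otimes> g"]) (auto simp flip: m_assoc)

text \<open>Replacing \<open>g\<close> by \<open>h \<otimes> g\<close> permutes the group, and
  \<open>inv g = inv (h \<otimes> g) \<otimes> h\<close>; this lets \<open>h\<close> move from the
  left of the sum to its right.\<close>

lemma (in group) average_intertwines:
  assumes R: "is_rep G R" and S: "is_rep G S" and Y: "Y \<in> carrier_mat (fst S) (fst R)"
  shows "intertwines G R S (average G R S Y)"
  unfolding intertwines_def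
proof (intro conjI ballI)
  fix h assume h: "h \<in> carrier G"
  have c: "snd S g * Y * snd R (inv g) \<in> carrier_mat (fst S) (fst R)" if "g \<in> carrier G" for g
    using that rep_carrier[OF R, of "inv g"] rep_carrier[OF S, of g] Y by auto
  have "snd S h * average G R S Y =
      msum (fst S) (fst R) (\<lambda>g. snd S h * (snd S g * Y * snd R (inv g))) (carrier G)"
    unfolding average_def by (rule mult_msum) (use h c S rep_carrier in auto)
  also have "\<dots> = msum (fst S) (fst R)
      (\<lambda>g. snd S (h \<otimes> g) * Y * snd R (inv (h \<otimes> g)) * snd R h) (carrier G)"
  proof (rule msum_cong)
    fix g assume g: "g \<in> carrier G"
    have "inv g = inv (h \<otimes> g) \<otimes> h" using g h by (simp add: inv_mult_group m_assoc)
    then have "snd R (inv g) = snd R (inv (h \<otimes> g)) * snd R h"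
      using g h R by (metis rep_mult inv_closed m_closed)
    then show "snd S h * (snd S g * Y * snd R (inv g)) =
        snd S (h \<otimes> g) * Y * snd R (inv (h \<otimes> g)) * snd R h"
      using g h Y by (simp add: rep_mult[OF S] mult_assoc_dim rep_dim[OF S] rep_dim[OF R])
  qed
  also have "\<dots> = msum (fst S) (fst R) (\<lambda>g. snd S g * Y * snd R (inv g) * snd R h) (carrier G)"
    unfolding msum_def
    by (intro cong_mat refl) (simp, rule sum.reindex_bij_betw[OF bij_betw_left_mult[OF h]])
  also have "\<dots> = average G R S Y * snd R h"
    unfolding average_def by (rule msum_mult[symmetric]) (use h c R rep_carrier in auto)
  finally show "average G R S Y * snd R h = snd S h * average G R S Y" ..
qed (simp add: average_def)

subsection \<open>Isomorphism\<close>

lemma rep_isoD: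
  assumes "rep_iso K R S"
  shows "fst R = fst S" and "\<exists>P Q. P \<in> carrier_mat (fst R) (fst R) \<and> Q \<in> carrier_mat (fst R) (fst R) \<and>
    Q * P = 1\<^sub>m (fst R) \<and> P * Q = 1\<^sub>m (fst R) \<and> (\<forall>g\<in>carrier K. P * snd R g = snd S g * P)"
proof -
  show "fst R = fst S" using assms by (simp add: rep_iso_def)
  obtain P where "P \<in> carrier (GL (fst R))" "\<forall>g\<in>carrier K. P * snd R g = snd S g * P"
    using assms unfolding rep_iso_def by blast
  then show "\<exists>P Q. P \<in> carrier_mat (fst R) (fst R) \<and> Q \<in> carrier_mat (fst R) (fst R) \<and>
    Q * P = 1\<^sub>m (fst R) \<and> P * Q = 1\<^sub>m (fst R) \<and> (\<forall>g\<in>carrier K. P * snd R g = snd S g * P)"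
    unfolding carrier_GL_iff by blast
qed

text \<open>A two-sided inverse forces the two dimensions to agree, as \<open>rep_iso\<close>
  demands. This allows \<open>P\<close> and \<open>Q\<close> to be built as rectangular block
  matrices.\<close>

lemma (in group) rep_isoI:
  assumes "is_rep G R" "is_rep G S" "intertwines G R S P" and Q: "Q \<in> carrier_mat (fst R) (fst S)"
    and QP: "Q * P = 1\<^sub>m (fst R)" and PQ: "P * Q = 1\<^sub>m (fst S)"
  shows "rep_iso G R S"
proof -
  have P: "P \<in> carrier_mat (fst S) (fst R)" using assms by (simp add: intertwines_def)
  have "fst R = fst S"
    using mult_left_inverse_le[OF P Q QP] mult_left_inverse_le[OF Q P PQ] by simp
  then have "P \<in> carrier (GL (fst R))" using P Q QP PQ unfolding carrier_GL_iff by auto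
  then show ?thesis using assms \<open>fst R = fst S\<close> unfolding rep_iso_def intertwines_def by auto
qed

lemma rep_iso_refl:
  assumes "\<And>g. g \<in> carrier K \<Longrightarrow> snd R g \<in> carrier_mat (fst R) (fst R)"
  shows "rep_iso K R R"
proof -
  have "1\<^sub>m (fst R) \<in> carrier (GL (fst R))" by (auto simp: carrier_GL_iff)
  moreover have "1\<^sub>m (fst R) * snd R g = snd R g * 1\<^sub>m (fst R)" if "g \<in> carrier K" for g
    using assms[OF that] by simp
  ultimately show ?thesis unfolding rep_iso_def by blast
qed

context group
begin

lemma rep_iso_sym:
  assumes R: "is_rep G R" and S: "is_rep G S" and iso: "rep_iso G R S"
  shows "rep_iso G S R"
proof -
  have dim: "fst R = fst S" using iso by (rule rep_isoD)
  from rep_isoD(2)[OF iso] obtain P Q where PQ: "P \<in> carrier_mat (fst R) (fst R)"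
    "Q \<in> carrier_mat (fst R) (fst R)" "Q * P = 1\<^sub>m (fst R)" "P * Q = 1\<^sub>m (fst R)"
    and c: "\<And>g. g \<in> carrier G \<Longrightarrow> P * snd R g = snd S g * P" by blast
  have "Q * snd S g = snd R g * Q" if g: "g \<in> carrier G" for g
  proof -
    have "Q * snd S g = Q * (snd S g * P) * Q"
      using PQ dim g by (simp add: mult_assoc_dim rep_dim[OF S])
    also have "\<dots> = Q * (P * snd R g) * Q" using c g by simp
    also have "\<dots> = (Q * P) * (snd R g * Q)"
      using PQ(1-2) g by (simp add: mult_assoc_dim rep_dim[OF R])
    finally show ?thesis using PQ(2,3) rep_dim[OF R g] by simp
  qed
  moreover have "Q \<in> carrier (GL (fst S))"
    by (rule carrier_GLI[of _ _ P]) (use PQ dim in simp_all)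
  ultimately show ?thesis using dim unfolding rep_iso_def by auto
qed

lemma rep_iso_trans:
  assumes R: "is_rep G R" and S: "is_rep G S" and T: "is_rep G T"
    and "rep_iso G R S" "rep_iso G S T"
  shows "rep_iso G R T"
proof -
  have dim: "fst R = fst S" "fst S = fst T" using assms rep_isoD(1) by blast+
  from rep_isoD(2)[OF \<open>rep_iso G R S\<close>] obtain P Q where PQ: "P \<in> carrier_mat (fst R) (fst R)"
    "Q \<in> carrier_mat (fst R) (fst R)" "Q * P = 1\<^sub>m (fst R)" "P * Q = 1\<^sub>m (fst R)"
    and c: "\<And>g. g \<in> carrier G \<Longrightarrow> P * snd R g = snd S g * P" by blast
  from rep_isoD(2)[OF \<open>rep_iso G S T\<close>] obtain P' Q' where PQ': "P' \<in> carrier_mat (fst S) (fst S)"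
    "Q' \<in> carrier_mat (fst S) (fst S)" "Q' * P' = 1\<^sub>m (fst S)" "P' * Q' = 1\<^sub>m (fst S)"
    and c': "\<And>g. g \<in> carrier G \<Longrightarrow> P' * snd S g = snd T g * P'" by blast
  have GL: "P' * P \<in> carrier (GL (fst R))"
    using PQ PQ' dim group.is_monoid[OF group_GL, THEN monoid.m_closed, of P' "fst R" P]
    by (auto simp: carrier_GL_iff)
  have "P' * P * snd R g = snd T g * (P' * P)" if g: "g \<in> carrier G" for g
  proof -
    have "P' * P * snd R g = P' * (snd S g * P)"
      using PQ PQ' dim g c by (simp add: mult_assoc_dim rep_dim[OF R])
    also have "\<dots> = P' * snd S g * P" using PQ PQ' dim g by (simp add: mult_assoc_dim rep_dim[OF S])
    also have "\<dots> = snd T g * P' * P" using c' g by simp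
    finally show ?thesis using PQ PQ' dim g by (simp add: mult_assoc_dim rep_dim[OF T])
  qed
  then show ?thesis using GL dim unfolding rep_iso_def by auto
qed

end

section \<open>Complete reducibility\<close>

text \<open>A direct summand in coordinates: \<open>A\<close> is an equivariant embedding of
  \<open>S\<close> into \<open>R\<close>, \<open>B\<close> an equivariant retraction, and
  \<open>A * B\<close> the projection of \<open>R\<close> onto the copy of \<open>S\<close>.\<close>

definition summand ::
  "('g, 'b) monoid_scheme \<Rightarrow> 'g rep \<Rightarrow> 'g rep \<Rightarrow> complex mat \<Rightarrow> complex mat \<Rightarrow> bool" where
  "summand K R S A B \<longleftrightarrow> is_rep K S \<and> intertwines K S R A \<and> intertwines K R S B \<and> B * A = 1\<^sub>m (fst S)"

lemma intertwines_smult: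
  assumes "intertwines K R S T" and "\<And>g. g \<in> carrier K \<Longrightarrow> snd R g \<in> carrier_mat (fst R) (fst R)"
    "\<And>g. g \<in> carrier K \<Longrightarrow> snd S g \<in> carrier_mat (fst S) (fst S)"
  shows "intertwines K R S (c \<cdot>\<^sub>m T)"
  using assms unfolding intertwines_def
  by (auto simp: mult_smult_assoc_mat[of _ "fst S" "fst R" _ "fst R"]
      mult_smult_distrib[of _ "fst S" "fst S" _ "fst R"])

lemma summand_dim:
  assumes "summand K R S A B"
  shows "dim_row A = fst R" "dim_col A = fst S" "dim_row B = fst S" "dim_col B = fst R"
    "A \<in> carrier_mat (fst R) (fst S)" "B \<in> carrier_mat (fst S) (fst R)"
  using assms unfolding summand_def intertwines_def by auto

lemma msum_one: "msum k k (\<lambda>_. 1\<^sub>m k) I = of_nat (card I) \<cdot>\<^sub>m 1\<^sub>m k"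
  by (rule eq_matI) (auto simp: msum_def)

lemma add_one_minus_mat: "(M :: complex mat) \<in> carrier_mat d d \<Longrightarrow> M + (1\<^sub>m d - M) = 1\<^sub>m d"
  by (intro eq_matI) auto

section \<open>Maschke's theorem and the splitting off of summands\<close>

context fin_group
begin

text \<open>Maschke's theorem. A basis \<open>A\<close> of \<open>W\<close> has a linear left
  inverse \<open>B\<close>; averaging \<open>B\<close> over the group makes it equivariant, and
  division by the group order makes it a retraction again.\<close>

lemma invariant_subspace_summand:
  assumes R: "is_rep K R"
    and W: "VectorSpace.subspace class_ring W (module_vec TYPE(complex) (fst R))"
    and inv: "\<And>g v. g \<in> carrier K \<Longrightarrow> v \<in> W \<Longrightarrow> snd R g *\<^sub>v v \<in> W"
  shows "\<exists>S A B. summand K R S A B \<and> W = (\<lambda>x. A *\<^sub>v x) ` carrier_vec (fst S)"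
proof -
  define d where "d = fst R"
  note Rc = rep_carrier[OF R, folded d_def] and Rd = rep_dim[OF R, folded d_def]
  obtain k A B where A: "A \<in> carrier_mat d k" and B: "B \<in> carrier_mat k d"
    and BA: "B * A = 1\<^sub>m k" and WA: "W = (\<lambda>x. A *\<^sub>v x) ` carrier_vec k"
  proof (rule subspace_as_range[of W d])
  qed (use W in \<open>auto simp: subspace_module_vec_iff d_def\<close>)
  \<comment> \<open>Invariance puts the columns of \<open>snd R g * A\<close> into \<open>W\<close>,
    the range of \<open>A\<close>, on which \<open>A * B\<close> is the identity.\<close>
  have ABR: "A * (B * (snd R g * A)) = snd R g * A" if g: "g \<in> carrier K" for g
  proof (rule eq_mat_mult_vecI[of _ d k])
    fix x :: "complex vec" assume x: "x \<in> carrier_vec k"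
    have "snd R g *\<^sub>v (A *\<^sub>v x) \<in> W" using inv[OF g] x WA by auto
    then obtain y where y: "y \<in> carrier_vec k" "snd R g *\<^sub>v (A *\<^sub>v x) = A *\<^sub>v y"
      using WA by auto
    have "(A * (B * (snd R g * A))) *\<^sub>v x = A *\<^sub>v (B *\<^sub>v (snd R g *\<^sub>v (A *\<^sub>v x)))"
      using A B x Rc[OF g] by (simp add: mult_vec_assoc_dim)
    also have "\<dots> = A *\<^sub>v ((B * A) *\<^sub>v y)"
      unfolding y(2) using A B y(1) by (subst assoc_mult_mat_vec[of B k d A k]) auto
    also have "\<dots> = snd R g *\<^sub>v (A *\<^sub>v x)" using y BA by simp
    also have "\<dots> = (snd R g * A) *\<^sub>v x" using A x Rc[OF g] by simp
    finally show "(A * (B * (snd R g * A))) *\<^sub>v x = (snd R g * A) *\<^sub>v x" .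
  qed (use A B Rc[OF g] in auto)
  \<comment> \<open>The action of \<open>R\<close> on \<open>W\<close> in the coordinates given by
    the columns of \<open>A\<close>.\<close>
  define S :: "'g rep" where "S = (k, \<lambda>g. B * (snd R g * A))"
  have S1: "fst S = k" "\<And>g. snd S g = B * (snd R g * A)" by (simp_all add: S_def)
  note dims = A B carrier_matD[OF A] carrier_matD[OF B]
  have S: "is_rep K S"
    unfolding is_rep_iff S1
  proof (intro conjI ballI)
    fix g h assume g: "g \<in> carrier K" and h: "h \<in> carrier K"
    have "B * (snd R (g \<otimes> h) * A) = B * (snd R g * (snd R h * A))"
      using g h dims by (simp add: rep_mult[OF R] mult_assoc_dim Rd)
    also have "\<dots> = B * (snd R g * (A * (B * (snd R h * A))))" using ABR[OF h] by simp
    also have "\<dots> = B * (snd R g * A) * (B * (snd R h * A))"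
      using g h dims by (simp add: mult_assoc_dim Rd)
    finally show "B * (snd R (g \<otimes> h) * A) = B * (snd R g * A) * (B * (snd R h * A))" .
  qed (use A B BA R in \<open>auto simp: rep_one d_def\<close>)
  have iA: "intertwines K S R A"
    unfolding intertwines_def S1 using A ABR by (auto simp: d_def)
  define n :: complex where "n = of_nat (card (carrier K))"
  have n: "n \<noteq> 0" using finite_carrier by (auto simp: n_def card_eq_0_iff)
  define B' where "B' = (1 / n) \<cdot>\<^sub>m average K R S B"
  have avg: "intertwines K R S (average K R S B)"
    using B by (intro average_intertwines R S) (simp add: S1 d_def)
  then have iB: "intertwines K R S B'"
    unfolding B'_def by (intro intertwines_smult rep_carrier R S)
  have c: "snd S g * B * snd R (inv g) \<in> carrier_mat k d" if g: "g \<in> carrier K" for g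
    using rep_carrier[OF S g, unfolded S1(1)] Rc[OF inv_closed[OF g]] B by auto
  have "average K R S B * A = msum k k (\<lambda>g. snd S g * B * snd R (inv g) * A) (carrier K)"
    unfolding average_def S1(1) d_def[symmetric]
    using A c by (rule msum_mult)
  also have "\<dots> = msum k k (\<lambda>g. 1\<^sub>m k) (carrier K)"
  proof (rule msum_cong)
    fix g assume g: "g \<in> carrier K"
    \<comment> \<open>The right-hand factor \<open>B * (snd R (inv g) * A)\<close> is by definition
      \<open>snd S (inv g)\<close>, so every term of the averaged sum is the identity.\<close>
    have "snd S g * B * snd R (inv g) * A = snd S g * (B * (snd R (inv g) * A))"
      using g dims rep_dim[OF S] by (simp add: mult_assoc_dim Rd S1(1))
    also have "\<dots> = snd S g * snd S (inv g)" by (simp add: S1(2))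
    finally show "snd S g * B * snd R (inv g) * A = 1\<^sub>m k" using rep_inv[OF S g] S1(1) by simp
  qed
  finally have "average K R S B * A = n \<cdot>\<^sub>m 1\<^sub>m k" by (simp add: msum_one n_def)
  then have "B' * A = 1\<^sub>m k"
    unfolding B'_def
    using A avg n by (subst mult_smult_assoc_mat[of _ k d _ k])
      (auto simp: intertwines_def S1 d_def intro!: eq_matI)
  then have "summand K R S A B'" using S iA iB unfolding summand_def S1 by simp
  then show ?thesis using WA[folded S1(1)] by blast
qed

lemma summand_trans:
  assumes R: "is_rep K R" and 1: "summand K R S A B" and 2: "summand K S S' A' B'"
  shows "summand K R S' (A * A') (B' * B)"
proof -
  note d = summand_dim[OF 1] summand_dim[OF 2]
  have S: "is_rep K S" "is_rep K S'" using 1 2 unfolding summand_def by auto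
  have "A * A' * snd S' g = snd R g * (A * A')" "B' * B * snd R g = snd S' g * (B' * B)"
    if g: "g \<in> carrier K" for g
  proof -
    note dd = rep_dim[OF R g] rep_dim[OF S(1) g] rep_dim[OF S(2) g]
    have c: "A' * snd S' g = snd S g * A'" "A * snd S g = snd R g * A"
      "B' * snd S g = snd S' g * B'" "B * snd R g = snd S g * B"
      using 1 2 g unfolding summand_def intertwines_def by auto
    have "A * A' * snd S' g = A * snd S g * A'"
      using d dd by (simp add: mult_assoc_dim c(1))
    then show "A * A' * snd S' g = snd R g * (A * A')"
      unfolding c(2) using d dd by (simp add: mult_assoc_dim)
    have "B' * B * snd R g = B' * snd S g * B"
      using d dd by (simp add: mult_assoc_dim c(4))
    then show "B' * B * snd R g = snd S' g * (B' * B)"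
      unfolding c(3) using d dd by (simp add: mult_assoc_dim)
  qed
  moreover have "B' * B * (A * A') = 1\<^sub>m (fst S')"
  proof -
    have "B' * B * (A * A') = B' * ((B * A) * A')" using d by (simp add: mult_assoc_dim)
    then show ?thesis using 1 2 d unfolding summand_def by simp
  qed
  ultimately show ?thesis using d S unfolding summand_def intertwines_def by auto
qed

text \<open>A summand of least positive dimension works: by Maschke an invariant subspace of it is a
  summand of \<open>R\<close> as well, so minimality makes this subspace either zero or
  everything.\<close>

lemma irreducible_summand:
  assumes R: "is_rep K R" and pos: "fst R > 0"
  shows "\<exists>S A B. summand K R S A B \<and> irreducible_rep K S"
proof -
  define P where "P k \<longleftrightarrow> k > 0 \<and> (\<exists>S A B. summand K R S A B \<and> fst S = k)" for k
  have "summand K R R (1\<^sub>m (fst R)) (1\<^sub>m (fst R))"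
    using R rep_dim[OF R] unfolding summand_def intertwines_def by auto
  then have "P (fst R)" using pos unfolding P_def by blast
  then have "P (LEAST k. P k)" by (rule LeastI)
  then obtain S A B where S: "summand K R S A B" "fst S > 0" and k: "fst S = (LEAST k. P k)"
    unfolding P_def by auto
  have repS: "is_rep K S" using S unfolding summand_def by simp
  have "W = {0\<^sub>v (fst S)} \<or> W = carrier_vec (fst S)"
    if W: "VectorSpace.subspace class_ring W (module_vec TYPE(complex) (fst S))"
      and inv: "\<forall>g\<in>carrier K. \<forall>v\<in>W. snd S g *\<^sub>v v \<in> W" for W
  proof -
    from invariant_subspace_summand[OF repS W] inv obtain S' A' B'
      where S': "summand K S S' A' B'" and WA: "W = (\<lambda>x. A' *\<^sub>v x) ` carrier_vec (fst S')" by blast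
    note d = summand_dim[OF S']
    have BA: "B' * A' = 1\<^sub>m (fst S')" using S' unfolding summand_def by simp
    have le: "fst S' \<le> fst S" using mult_left_inverse_le[OF d(5,6) BA] .
    show ?thesis
    proof (cases "fst S' = 0")
      case True
      have z: "A' *\<^sub>v x = 0\<^sub>v (fst S)" if "x \<in> carrier_vec 0" for x
        using that d True by (intro eq_vecI) (auto simp: scalar_prod_def)
      have "w = 0\<^sub>v (fst S)" if "w \<in> W" for w
        using that z unfolding WA True by (elim imageE) simp
      moreover have "0\<^sub>v (fst S) \<in> W" using W by (simp add: subspace_module_vec_iff)
      ultimately have "W = {0\<^sub>v (fst S)}" by blast
      then show ?thesis ..
    next
      case False
      then have "P (fst S')" unfolding P_def using summand_trans[OF R S(1) S'] by blast
      then have "fst S \<le> fst S'" unfolding k by (rule Least_le)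
      then have eq: "fst S' = fst S" using le by simp
      then have AB: "A' * B' = 1\<^sub>m (fst S)" using mat_mult_left_right_inverse BA d by metis
      have "v \<in> W" if v: "v \<in> carrier_vec (fst S)" for v
      proof -
        have "A' *\<^sub>v (B' *\<^sub>v v) = (A' * B') *\<^sub>v v"
          using d v eq by (intro assoc_mult_mat_vec[symmetric, of _ "fst S" "fst S" _ "fst S"]) auto
        then have "v = A' *\<^sub>v (B' *\<^sub>v v)" using AB v by simp
        moreover have "B' *\<^sub>v v \<in> carrier_vec (fst S')" using d v by auto
        ultimately show ?thesis unfolding WA by blast
      qed
      moreover have "W \<subseteq> carrier_vec (fst S)" using W unfolding subspace_module_vec_iff by simp
      ultimately show ?thesis by blast
    qed
  qed
  then have "irreducible_rep K S" using repS S(2) unfolding irreducible_rep_def by blast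
  then show ?thesis using S(1) by blast
qed

text \<open>The complement is the range of the idempotent \<open>1 - A * B\<close>. It is invariant
  because the idempotent commutes with the action, so Maschke presents it as a summand.\<close>

lemma summand_complement:
  assumes R: "is_rep K R" and S: "summand K R S A B"
  shows "\<exists>S' A' B'. summand K R S' A' B' \<and> A * B + A' * B' = 1\<^sub>m (fst R) \<and>
    B * A' = 0\<^sub>m (fst S) (fst S') \<and> B' * A = 0\<^sub>m (fst S') (fst S)"
proof -
  define d where "d = fst R"
  note Rd = rep_dim[OF R, folded d_def] and Rc = rep_carrier[OF R, folded d_def]
  note dS = summand_dim[OF S, folded d_def]
  note AB = S[unfolded summand_def intertwines_def]
  have BA: "B * A = 1\<^sub>m (fst S)" using AB by simp
  have repS: "is_rep K S" using AB by simp
  define E where "E = 1\<^sub>m d - A * B"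
  have E: "E \<in> carrier_mat d d" using dS unfolding E_def by auto
  have dE: "dim_row E = d" "dim_col E = d" using E by auto
  have "E * A = 1\<^sub>m d * A - A * B * A"
    unfolding E_def using dS by (intro minus_mult_distrib_mat[of _ d d]) auto
  also have "A * B * A = A" using dS BA by (simp add: mult_assoc_dim)
  finally have EA: "E * A = 0\<^sub>m d (fst S)" using dS by auto
  have "B * E = B * 1\<^sub>m d - B * (A * B)"
    unfolding E_def using dS by (intro mult_minus_distrib_mat[of _ _ d]) auto
  also have "B * (A * B) = B * A * B" using dS by (simp add: mult_assoc_dim)
  also have "\<dots> = B" using dS BA by simp
  finally have BE: "B * E = 0\<^sub>m (fst S) d" using dS by auto
  have "E * E = E * 1\<^sub>m d - E * (A * B)"
    unfolding E_def using dS by (intro mult_minus_distrib_mat[of _ d d]) auto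
  also have "E * (A * B) = E * A * B" using dS dE by (simp add: mult_assoc_dim)
  also have "\<dots> = 0\<^sub>m d d" unfolding EA using dS by simp
  finally have EE: "E * E = E" using E by auto
  have ER: "E * snd R g = snd R g * E" if g: "g \<in> carrier K" for g
  proof -
    have "E * snd R g = 1\<^sub>m d * snd R g - A * B * snd R g"
      unfolding E_def using dS Rc[OF g] by (intro minus_mult_distrib_mat[of _ d d]) auto
    also have "A * B * snd R g = A * (B * snd R g)"
      using dS Rd[OF g] by (simp add: mult_assoc_dim)
    also have "B * snd R g = snd S g * B" using AB g by simp
    also have "A * (snd S g * B) = A * snd S g * B"
      using dS rep_dim[OF repS g] by (simp add: mult_assoc_dim)
    also have "\<dots> = snd R g * A * B" using AB g by simp
    also have "\<dots> = snd R g * (A * B)" using dS Rd[OF g] by (simp add: mult_assoc_dim)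
    also have "1\<^sub>m d * snd R g - snd R g * (A * B) = snd R g * 1\<^sub>m d - snd R g * (A * B)"
      using Rc[OF g] by simp
    also have "\<dots> = snd R g * E"
      unfolding E_def using dS Rc[OF g] by (intro mult_minus_distrib_mat[symmetric, of _ d d]) auto
    finally show ?thesis .
  qed
  define W where "W = (\<lambda>v. E *\<^sub>v v) ` carrier_vec d"
  have sub: "VectorSpace.subspace class_ring W (module_vec TYPE(complex) (fst R))"
    unfolding subspace_module_vec_iff d_def[symmetric]
  proof (intro conjI ballI allI)
    show "W \<subseteq> carrier_vec d" using E unfolding W_def by auto
    have "0\<^sub>v d = E *\<^sub>v 0\<^sub>v d" using E by auto
    then show "0\<^sub>v d \<in> W" unfolding W_def by (rule image_eqI) simp
  next
    fix v w assume "v \<in> W" "w \<in> W"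
    then obtain x y where x: "x \<in> carrier_vec d" "v = E *\<^sub>v x" "y \<in> carrier_vec d" "w = E *\<^sub>v y"
      unfolding W_def by blast
    then have "v + w = E *\<^sub>v (x + y)" using E by (simp add: mult_add_distrib_mat_vec[of _ d d])
    then show "v + w \<in> W" unfolding W_def by (rule image_eqI) (use x in simp)
  next
    fix c v assume "v \<in> W"
    then obtain x where x: "x \<in> carrier_vec d" "v = E *\<^sub>v x" unfolding W_def by blast
    then have "c \<cdot>\<^sub>v v = E *\<^sub>v (c \<cdot>\<^sub>v x)" using E by (simp add: mult_mat_vec[of _ d d])
    then show "c \<cdot>\<^sub>v v \<in> W" unfolding W_def by (rule image_eqI) (use x in simp)
  qed
  have "snd R g *\<^sub>v v \<in> W" if g: "g \<in> carrier K" and v: "v \<in> W" for g v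
  proof -
    obtain x where x: "x \<in> carrier_vec d" "v = E *\<^sub>v x" using v unfolding W_def by blast
    have "snd R g *\<^sub>v v = (snd R g * E) *\<^sub>v x" using x E Rc[OF g] by simp
    also have "\<dots> = E *\<^sub>v (snd R g *\<^sub>v x)" unfolding ER[OF g, symmetric] using x E Rc[OF g] by simp
    finally show ?thesis unfolding W_def by (rule image_eqI) (use x Rc[OF g] in auto)
  qed
  from invariant_subspace_summand[OF R sub this] obtain S' A' B'
    where S': "summand K R S' A' B'" and WA: "W = (\<lambda>x. A' *\<^sub>v x) ` carrier_vec (fst S')" by blast
  note dS' = summand_dim[OF S', folded d_def]
  note AB' = S'[unfolded summand_def intertwines_def]
  have repS': "is_rep K S'" and BA': "B' * A' = 1\<^sub>m (fst S')" using AB' by simp_all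
  have EA': "E * A' = A'"
  proof (rule eq_mat_mult_vecI[of _ d "fst S'"])
    fix x :: "complex vec" assume x: "x \<in> carrier_vec (fst S')"
    then have "A' *\<^sub>v x \<in> W" using WA by blast
    then obtain y where y: "y \<in> carrier_vec d" "A' *\<^sub>v x = E *\<^sub>v y" unfolding W_def by blast
    have "(E * A') *\<^sub>v x = E *\<^sub>v (E *\<^sub>v y)"
      unfolding y(2)[symmetric] using E dS' x by (intro assoc_mult_mat_vec) auto
    also have "\<dots> = (E * E) *\<^sub>v y" using E y(1) by simp
    finally show "(E * A') *\<^sub>v x = A' *\<^sub>v x" using y EE by simp
  qed (use E dS' in auto)
  have ABE: "A' * B' * E = E"
  proof (rule eq_mat_mult_vecI[of _ d d])
    fix x :: "complex vec" assume x: "x \<in> carrier_vec d"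
    then have "E *\<^sub>v x \<in> W" unfolding W_def by blast
    then obtain y where y: "y \<in> carrier_vec (fst S')" "E *\<^sub>v x = A' *\<^sub>v y" unfolding WA by blast
    have "(A' * B' * E) *\<^sub>v x = (A' * B') *\<^sub>v (A' *\<^sub>v y)"
      unfolding y(2)[symmetric] using E dS' x by (intro assoc_mult_mat_vec[of _ d d]) auto
    also have "\<dots> = (A' * B' * A') *\<^sub>v y"
      using dS' y by (intro assoc_mult_mat_vec[symmetric, of _ d d]) auto
    also have "A' * B' * A' = A'" using BA' dS' by (simp add: mult_assoc_dim)
    finally show "(A' * B' * E) *\<^sub>v x = E *\<^sub>v x" using y by simp
  qed (use E dS' in auto)
  \<comment> \<open>The retraction \<open>B'\<close> supplied by Maschke need not vanish on the
    range of \<open>A\<close>. Composing it with \<open>E\<close> enforces this and changes nothing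
    on the range of \<open>A'\<close>, which \<open>E\<close> fixes.\<close>
  have "B' * E * A' = 1\<^sub>m (fst S')" using BA' EA' dS' dE by (simp add: mult_assoc_dim)
  moreover have "B' * E * snd R g = snd S' g * (B' * E)" if g: "g \<in> carrier K" for g
  proof -
    have "B' * E * snd R g = B' * snd R g * E"
      using dS' dE Rd[OF g] by (simp add: mult_assoc_dim ER[OF g])
    also have "B' * snd R g = snd S' g * B'" using AB' g by simp
    finally show ?thesis using dS' dE rep_dim[OF repS' g] by (simp add: mult_assoc_dim)
  qed
  ultimately have "summand K R S' A' (B' * E)"
    using AB' dS' E unfolding summand_def intertwines_def by (auto simp: d_def)
  moreover have "A * B + A' * (B' * E) = 1\<^sub>m d"
  proof -
    have "A' * (B' * E) = E" using ABE dS' dE by (simp add: mult_assoc_dim)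
    moreover have "A * B \<in> carrier_mat d d" using dS by auto
    then have "A * B + E = 1\<^sub>m d" unfolding E_def by (rule add_one_minus_mat)
    ultimately show ?thesis by simp
  qed
  moreover have "B * A' = 0\<^sub>m (fst S) (fst S')"
  proof -
    have "B * A' = B * E * A'" using EA' dS dS' dE by (simp add: mult_assoc_dim)
    then show ?thesis unfolding BE using dS' by simp
  qed
  moreover have "B' * E * A = 0\<^sub>m (fst S') (fst S)"
    using EA dS dS' dE by (simp add: mult_assoc_dim)
  ultimately show ?thesis unfolding d_def by blast
qed

end

text \<open>The binary sum follows the recursion of \<open>diag_block_mat\<close>, so that
  \<open>direct_sum_rep\<close> can be treated by induction on the list.\<close>

definition dsum_rep :: "'g rep \<Rightarrow> 'g rep \<Rightarrow> 'g rep" where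
  "dsum_rep S T = (fst S + fst T, \<lambda>g. four_block_mat (snd S g) (0\<^sub>m (fst S) (fst T))
     (0\<^sub>m (fst T) (fst S)) (snd T g))"

lemma fst_dsum_rep [simp]: "fst (dsum_rep S T) = fst S + fst T"
  by (simp add: dsum_rep_def)

lemma four_block_mat_trivial:
  "(M :: complex mat) \<in> carrier_mat n m \<Longrightarrow> four_block_mat M (0\<^sub>m n 0) (0\<^sub>m 0 m) (0\<^sub>m 0 0) = M"
  by (intro eq_matI) auto

lemma mult_diag_four_block_mat:
  fixes A B C D :: "complex mat"
  assumes "A \<in> carrier_mat n n" "B \<in> carrier_mat n n" "C \<in> carrier_mat m m" "D \<in> carrier_mat m m"
  shows "four_block_mat A (0\<^sub>m n m) (0\<^sub>m m n) C * four_block_mat B (0\<^sub>m n m) (0\<^sub>m m n) D =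
    four_block_mat (A * B) (0\<^sub>m n m) (0\<^sub>m m n) (C * D)"
  using assms by (subst mult_four_block_mat[of _ n n _ m _ m _ _ n _ m]) auto

lemma rep_iso_cong:
  "fst S = fst S' \<Longrightarrow> (\<And>g. g \<in> carrier K \<Longrightarrow> snd S g = snd S' g) \<Longrightarrow> rep_iso K R S \<longleftrightarrow> rep_iso K R S'"
  unfolding rep_iso_def by auto

context group
begin

lemma is_rep_cong:
  "fst R = fst S \<Longrightarrow> (\<And>g. g \<in> carrier G \<Longrightarrow> snd R g = snd S g) \<Longrightarrow> is_rep G R \<longleftrightarrow> is_rep G S"
  unfolding is_rep_iff by simp

lemma is_rep_dsum: "is_rep G S \<Longrightarrow> is_rep G T \<Longrightarrow> is_rep G (dsum_rep S T)"
  unfolding is_rep_iff by (auto simp: dsum_rep_def mult_diag_four_block_mat)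

lemma rep_iso_dsum:
  assumes R: "is_rep G S" "is_rep G S'" "is_rep G T" "is_rep G T'"
    and S: "rep_iso G S S'" and T: "rep_iso G T T'"
  shows "rep_iso G (dsum_rep S T) (dsum_rep S' T')"
proof -
  define k l where "k = fst S" and "l = fst T"
  have kl: "fst S' = k" "fst T' = l" using rep_isoD(1)[OF S] rep_isoD(1)[OF T] by (simp_all add: k_def l_def)
  obtain P Q where P: "P \<in> carrier_mat k k" "Q \<in> carrier_mat k k" "Q * P = 1\<^sub>m k" "P * Q = 1\<^sub>m k"
    and cP: "\<And>g. g \<in> carrier G \<Longrightarrow> P * snd S g = snd S' g * P"
    using rep_isoD(2)[OF S] unfolding k_def by blast
  obtain P' Q' where P': "P' \<in> carrier_mat l l" "Q' \<in> carrier_mat l l" "Q' * P' = 1\<^sub>m l" "P' * Q' = 1\<^sub>m l"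
    and cP': "\<And>g. g \<in> carrier G \<Longrightarrow> P' * snd T g = snd T' g * P'"
    using rep_isoD(2)[OF T] unfolding l_def by blast
  let ?P = "four_block_mat P (0\<^sub>m k l) (0\<^sub>m l k) P'"
  let ?Q = "four_block_mat Q (0\<^sub>m k l) (0\<^sub>m l k) Q'"
  note c = rep_carrier[OF R(1), folded k_def] rep_carrier[OF R(2), unfolded kl]
    rep_carrier[OF R(3), folded l_def] rep_carrier[OF R(4), unfolded kl]
  show ?thesis
  proof (rule rep_isoI[of _ _ ?P ?Q])
    show "intertwines G (dsum_rep S T) (dsum_rep S' T') ?P"
      using P P' c kl by (auto simp: intertwines_def dsum_rep_def k_def[symmetric] l_def[symmetric]
          mult_diag_four_block_mat cP cP')
  qed (use P P' kl R in \<open>auto simp: is_rep_dsum mult_diag_four_block_mat k_def[symmetric] l_def[symmetric]\<close>)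
qed

text \<open>The isomorphism stacks \<open>B\<close> on \<open>B'\<close>, and its inverse puts
  \<open>A\<close> beside \<open>A'\<close>. Both are written as four-block matrices with an empty
  block column or row, so that block multiplication applies; the hypotheses are precisely the
  entries of the two products.\<close>

lemma rep_iso_dsum_complement:
  assumes R: "is_rep G R" and S: "summand G R S A B" and S': "summand G R S' A' B'"
    and sum: "A * B + A' * B' = 1\<^sub>m (fst R)"
    and BA': "B * A' = 0\<^sub>m (fst S) (fst S')" and BA: "B' * A = 0\<^sub>m (fst S') (fst S)"
  shows "rep_iso G R (dsum_rep S S')"
proof -
  define d k l where "d = fst R" and "k = fst S" and "l = fst S'"
  note dS = summand_dim(5,6)[OF S, folded d_def k_def] and dS' = summand_dim(5,6)[OF S', folded d_def l_def]
  have rep: "is_rep G S" "is_rep G S'" using S S' unfolding summand_def by auto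
  note c = rep_carrier[OF R, folded d_def] rep_carrier[OF rep(1), folded k_def] rep_carrier[OF rep(2), folded l_def]
  let ?P = "four_block_mat B (0\<^sub>m k 0) B' (0\<^sub>m l 0)"
  let ?Q = "four_block_mat A A' (0\<^sub>m 0 k) (0\<^sub>m 0 l)"
  show ?thesis
  proof (rule rep_isoI[of _ _ ?P ?Q])
    show "is_rep G R" "is_rep G (dsum_rep S S')" using R rep is_rep_dsum by auto
    have "?P * snd R g = snd (dsum_rep S S') g * ?P" if g: "g \<in> carrier G" for g
    proof -
      have "?P * snd R g = ?P * four_block_mat (snd R g) (0\<^sub>m d 0) (0\<^sub>m 0 d) (0\<^sub>m 0 0)"
        using c(1)[OF g] by (simp add: four_block_mat_trivial)
      also have "\<dots> = four_block_mat (B * snd R g) (0\<^sub>m k 0) (B' * snd R g) (0\<^sub>m l 0)"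
        using c(1)[OF g] dS dS' by (subst mult_four_block_mat[of _ k d _ 0 _ l _ _ d _ 0]) auto
      also have "B * snd R g = snd S g * B" using S g unfolding summand_def intertwines_def by simp
      also have "B' * snd R g = snd S' g * B'" using S' g unfolding summand_def intertwines_def by simp
      also have "four_block_mat (snd S g * B) (0\<^sub>m k 0) (snd S' g * B') (0\<^sub>m l 0) =
          snd (dsum_rep S S') g * ?P"
        using c[OF g] dS dS' unfolding dsum_rep_def snd_conv k_def[symmetric] l_def[symmetric]
        by (subst mult_four_block_mat[of _ k k _ l _ l _ _ d _ 0]) auto
      finally show ?thesis .
    qed
    moreover have "?P \<in> carrier_mat (fst (dsum_rep S S')) (fst R)"
      using dS dS' four_block_carrier_mat[of B k d "0\<^sub>m l 0" l 0 "0\<^sub>m k 0" B']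
      by (simp add: d_def k_def l_def)
    ultimately show "intertwines G R (dsum_rep S S') ?P" unfolding intertwines_def by blast
    show "?Q \<in> carrier_mat (fst R) (fst (dsum_rep S S'))"
      using dS dS' four_block_carrier_mat[of A d k "0\<^sub>m 0 l" 0 l A' "0\<^sub>m 0 k"]
      by (simp add: d_def k_def l_def)
    have "?Q * ?P = four_block_mat (A * B + A' * B') (0\<^sub>m d 0) (0\<^sub>m 0 d) (0\<^sub>m 0 0)"
      using dS dS' by (subst mult_four_block_mat[of _ d k _ l _ 0 _ _ d _ 0]) auto
    then show "?Q * ?P = 1\<^sub>m (fst R)" unfolding sum by (simp add: d_def four_block_mat_trivial)
    have "?P * ?Q = four_block_mat (B * A) (B * A') (B' * A) (B' * A')"
      using dS dS' by (subst mult_four_block_mat[of _ k d _ 0 _ l _ _ k _ l]) auto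
    also have "\<dots> = 1\<^sub>m (fst (dsum_rep S S'))"
      using S S' unfolding BA BA' summand_def by simp
    finally show "?P * ?Q = 1\<^sub>m (fst (dsum_rep S S'))" .
  qed
qed

lemma is_rep_direct_sum:
  assumes "\<forall>S\<in>set Ss. is_rep G S"
  shows "is_rep G (direct_sum_rep Ss)"
  using assms
proof (induction Ss)
  case Nil
  then show ?case by (auto simp: is_rep_iff direct_sum_rep_def)
next
  case (Cons S Ss)
  then have S: "is_rep G S" and Ss: "is_rep G (direct_sum_rep Ss)" by auto
  have "fst (direct_sum_rep (S # Ss)) = fst (dsum_rep S (direct_sum_rep Ss))"
    by (simp add: direct_sum_rep_def)
  moreover have "snd (direct_sum_rep (S # Ss)) g = snd (dsum_rep S (direct_sum_rep Ss)) g"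
    if "g \<in> carrier G" for g
    using rep_dim[OF S that] rep_dim[OF Ss that]
    by (simp add: direct_sum_rep_def dsum_rep_def Let_def)
  ultimately show ?case using is_rep_cong is_rep_dsum[OF S Ss] by metis
qed

lemma direct_sum_rep_Cons:
  assumes S: "is_rep G S" and Ss: "\<forall>S\<in>set Ss. is_rep G S"
  shows "fst (direct_sum_rep (S # Ss)) = fst (dsum_rep S (direct_sum_rep Ss))"
    and "g \<in> carrier G \<Longrightarrow> snd (direct_sum_rep (S # Ss)) g = snd (dsum_rep S (direct_sum_rep Ss)) g"
  using rep_dim[OF S] rep_dim[OF is_rep_direct_sum[OF Ss]]
  by (simp_all add: direct_sum_rep_def dsum_rep_def Let_def)

end

subsection \<open>Isomorphism classes of irreducible representations\<close>

text \<open>With the condition on \<open>R\<close> included, this is literally the image of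
  \<open>R\<close> under the relation that defines \<open>irr_classes\<close>.\<close>

definition irr_class :: "('g, 'b) monoid_scheme \<Rightarrow> 'g rep \<Rightarrow> 'g rep set" where
  "irr_class K R = {S. irreducible_rep K R \<and> irreducible_rep K S \<and> rep_iso K R S}"

lemma irreducible_is_rep: "irreducible_rep K R \<Longrightarrow> is_rep K R"
  and irreducible_pos: "irreducible_rep K R \<Longrightarrow> fst R > 0"
  by (simp_all add: irreducible_rep_def)

context group
begin

lemma irr_classes_eq: "irr_classes G = irr_class G ` {R. irreducible_rep G R}"
  by (auto simp: irr_classes_def quotient_def irr_class_def)

lemma irr_class_self: "irreducible_rep G R \<Longrightarrow> R \<in> irr_class G R"
  by (simp add: irr_class_def rep_iso_refl rep_carrier irreducible_is_rep)

lemma irr_class_eq_iff: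
  assumes R: "irreducible_rep G R" and S: "irreducible_rep G S"
  shows "irr_class G R = irr_class G S \<longleftrightarrow> rep_iso G R S"
proof
  assume "irr_class G R = irr_class G S"
  then have "S \<in> irr_class G R" using irr_class_self[OF S] by simp
  then show "rep_iso G R S" by (simp add: irr_class_def)
next
  assume iso: "rep_iso G R S"
  then have iso': "rep_iso G S R" using R S by (simp add: rep_iso_sym irreducible_is_rep)
  show "irr_class G R = irr_class G S"
    unfolding irr_class_def using R S iso iso' rep_iso_trans irreducible_is_rep by blast
qed

lemma class_rep_irr_class:
  assumes "irreducible_rep G R"
  shows "irreducible_rep G (class_rep (irr_class G R))" "rep_iso G R (class_rep (irr_class G R))"
proof -
  have "class_rep (irr_class G R) \<in> irr_class G R"
    unfolding class_rep_def using irr_class_self[OF assms] by (rule someI)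
  then show "irreducible_rep G (class_rep (irr_class G R))" "rep_iso G R (class_rep (irr_class G R))"
    unfolding irr_class_def by blast+
qed

lemma irreducible_class_rep: "C \<in> irr_classes G \<Longrightarrow> irreducible_rep G (class_rep C)"
  and irr_class_class_rep: "C \<in> irr_classes G \<Longrightarrow> irr_class G (class_rep C) = C"
  using class_rep_irr_class by (auto simp: irr_classes_eq irr_class_eq_iff)
    (metis class_rep_irr_class irr_class_eq_iff)+

lemma irr_class_in_classes: "irreducible_rep G R \<Longrightarrow> irr_class G R \<in> irr_classes G"
  by (auto simp: irr_classes_eq)

lemma rep_iso_class_rep_iff:
  "C \<in> irr_classes G \<Longrightarrow> D \<in> irr_classes G \<Longrightarrow> rep_iso G (class_rep C) (class_rep D) \<longleftrightarrow> C = D"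
  by (metis irr_class_eq_iff irreducible_class_rep irr_class_class_rep)

end

text \<open>Induction on the dimension: an irreducible summand has positive dimension, so its
  complement is strictly smaller. The empty list serves dimension 0. The conclusion has the form
  required by \<open>irr_mult\<close> and gives the existence of multiplicities.\<close>

theorem (in fin_group) complete_reducibility:
  assumes "is_rep K R"
  shows "\<exists>Cs. set Cs \<subseteq> irr_classes K \<and> rep_iso K R (direct_sum_rep (map class_rep Cs))"
  using assms
proof (induction "fst R" arbitrary: R rule: less_induct)
  case less
  note R = less.prems
  show ?case
  proof (cases "fst R = 0")
    case True
    have "rep_iso K R (direct_sum_rep [])"
    proof (rule rep_isoI[of _ _ "1\<^sub>m 0" "1\<^sub>m 0"])
      show "is_rep K (direct_sum_rep [])" by (rule is_rep_direct_sum) simp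
      have "M = N" if "M \<in> carrier_mat 0 0" "N \<in> carrier_mat 0 0" for M N :: "complex mat"
        using that by (intro eq_matI) auto
      then show "intertwines K R (direct_sum_rep []) (1\<^sub>m 0)"
        using True rep_dim[OF R] by (auto simp: intertwines_def direct_sum_rep_def)
    qed (use R True in \<open>auto simp: direct_sum_rep_def\<close>)
    then show ?thesis by (intro exI[of _ "[]"]) auto
  next
    case False
    then obtain S A B where S: "summand K R S A B" and irr: "irreducible_rep K S"
      using irreducible_summand[OF R] by auto
    obtain S' A' B' where S': "summand K R S' A' B'" "A * B + A' * B' = 1\<^sub>m (fst R)"
      "B * A' = 0\<^sub>m (fst S) (fst S')" "B' * A = 0\<^sub>m (fst S') (fst S)"
      using summand_complement[OF R S] by blast
    have repS: "is_rep K S" and repS': "is_rep K S'" using S S' unfolding summand_def by auto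
    have iso: "rep_iso K R (dsum_rep S S')" by (rule rep_iso_dsum_complement[OF R S S'])
    then have "fst S' < fst R" using rep_isoD(1)[OF iso] irreducible_pos[OF irr] by simp
    then obtain Cs where Cs: "set Cs \<subseteq> irr_classes K" "rep_iso K S' (direct_sum_rep (map class_rep Cs))"
      using less.hyps repS' by blast
    define C where "C = irr_class K S"
    have C: "C \<in> irr_classes K" unfolding C_def using irr by (rule irr_class_in_classes)
    have reps: "\<forall>S\<in>set (map class_rep Cs). is_rep K S"
      using Cs(1) by (auto intro!: irreducible_is_rep irreducible_class_rep)
    have repC: "is_rep K (class_rep C)" using C irreducible_class_rep irreducible_is_rep by blast
    have "rep_iso K (dsum_rep S S') (dsum_rep (class_rep C) (direct_sum_rep (map class_rep Cs)))"
      using class_rep_irr_class(2)[OF irr] Cs(2) unfolding C_def[symmetric]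
      by (intro rep_iso_dsum repS repS' repC is_rep_direct_sum[OF reps])
    then have "rep_iso K R (dsum_rep (class_rep C) (direct_sum_rep (map class_rep Cs)))"
      by (rule rep_iso_trans[OF R is_rep_dsum[OF repS repS'] is_rep_dsum[OF repC is_rep_direct_sum[OF reps]] iso])
    then have "rep_iso K R (direct_sum_rep (class_rep C # map class_rep Cs))"
      using rep_iso_cong[OF direct_sum_rep_Cons[OF repC reps]] by blast
    then show ?thesis using C Cs(1) by (intro exI[of _ "C # Cs"]) auto
  qed
qed

section \<open>Schur's lemma and character orthogonality\<close>

context group
begin

text \<open>Schur's lemma. The kernel \<open>N\<close> and the image \<open>W\<close> of
  \<open>T\<close> are invariant; as \<open>T\<close> is nonzero, irreducibility of \<open>R\<close>
  makes the kernel zero and irreducibility of \<open>S\<close> makes the image everything.\<close>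

lemma schur_inverse:
  assumes R: "irreducible_rep G R" and S: "irreducible_rep G S" and T: "intertwines G R S T"
    and nz: "T \<noteq> 0\<^sub>m (fst S) (fst R)"
  shows "\<exists>U\<in>carrier_mat (fst R) (fst S). U * T = 1\<^sub>m (fst R) \<and> T * U = 1\<^sub>m (fst S)"
proof -
  define n k where "n = fst R" and "k = fst S"
  have Tc: "T \<in> carrier_mat k n" and TR: "\<And>g. g \<in> carrier G \<Longrightarrow> T * snd R g = snd S g * T"
    using T by (simp_all add: intertwines_def n_def k_def)
  note Rc = rep_carrier[OF irreducible_is_rep[OF R], folded n_def]
    and Sc = rep_carrier[OF irreducible_is_rep[OF S], folded k_def]
  have act: "snd S g *\<^sub>v (T *\<^sub>v x) = T *\<^sub>v (snd R g *\<^sub>v x)" if "g \<in> carrier G" "x \<in> carrier_vec n" for g x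
    using assoc_mult_mat_vec[OF Sc[OF that(1)] Tc that(2)] assoc_mult_mat_vec[OF Tc Rc[OF that(1)] that(2)]
      TR[OF that(1)] by simp
  define N where "N = {v \<in> carrier_vec n. T *\<^sub>v v = 0\<^sub>v k}"
  have "VectorSpace.subspace class_ring N (module_vec TYPE(complex) n)"
    unfolding subspace_module_vec_iff N_def using Tc
    by (auto simp: mult_add_distrib_mat_vec[of _ k n] mult_mat_vec[of _ k n])
  moreover have "snd R g *\<^sub>v v \<in> N" if g: "g \<in> carrier G" and v: "v \<in> N" for g v
  proof -
    have v: "v \<in> carrier_vec n" "T *\<^sub>v v = 0\<^sub>v k" using v by (auto simp: N_def)
    have "T *\<^sub>v (snd R g *\<^sub>v v) = snd S g *\<^sub>v 0\<^sub>v k" using act[OF g v(1)] v(2) by simp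
    also have "\<dots> = 0\<^sub>v k" using Sc[OF g] by auto
    finally show ?thesis using v Rc[OF g] by (auto simp: N_def)
  qed
  ultimately have "N = {0\<^sub>v n} \<or> N = carrier_vec n"
    using R unfolding irreducible_rep_def n_def by blast
  moreover have "N \<noteq> carrier_vec n"
  proof
    assume N: "N = carrier_vec n"
    have "T = 0\<^sub>m k n"
    proof (rule eq_mat_mult_vecI[OF Tc])
      fix x :: "complex vec" assume x: "x \<in> carrier_vec n"
      have "x \<in> N" using x N by simp
      moreover have "0\<^sub>m k n *\<^sub>v x = 0\<^sub>v k"
        using x by (intro eq_vecI) (auto simp: scalar_prod_def)
      ultimately show "T *\<^sub>v x = 0\<^sub>m k n *\<^sub>v x" by (simp add: N_def)
    qed simp
    then show False using nz by (simp add: n_def k_def)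
  qed
  ultimately have N0: "N = {0\<^sub>v n}" by blast
  define W where "W = (\<lambda>v. T *\<^sub>v v) ` carrier_vec n"
  have "VectorSpace.subspace class_ring W (module_vec TYPE(complex) k)"
    unfolding subspace_module_vec_iff
  proof (intro conjI ballI allI)
    show "W \<subseteq> carrier_vec k" using Tc unfolding W_def by auto
    have "0\<^sub>v k = T *\<^sub>v 0\<^sub>v n" using Tc by auto
    then show "0\<^sub>v k \<in> W" unfolding W_def by (rule image_eqI) simp
  next
    fix v w assume "v \<in> W" "w \<in> W"
    then obtain x y where x: "x \<in> carrier_vec n" "v = T *\<^sub>v x" "y \<in> carrier_vec n" "w = T *\<^sub>v y"
      unfolding W_def by blast
    then have "v + w = T *\<^sub>v (x + y)" using Tc by (simp add: mult_add_distrib_mat_vec[of _ k n])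
    then show "v + w \<in> W" unfolding W_def by (rule image_eqI) (use x in simp)
  next
    fix c v assume "v \<in> W"
    then obtain x where x: "x \<in> carrier_vec n" "v = T *\<^sub>v x" unfolding W_def by blast
    then have "c \<cdot>\<^sub>v v = T *\<^sub>v (c \<cdot>\<^sub>v x)" using Tc by (simp add: mult_mat_vec[of _ k n])
    then show "c \<cdot>\<^sub>v v \<in> W" unfolding W_def by (rule image_eqI) (use x in simp)
  qed
  moreover have "snd S g *\<^sub>v v \<in> W" if g: "g \<in> carrier G" and v: "v \<in> W" for g v
  proof -
    obtain x where x: "x \<in> carrier_vec n" "v = T *\<^sub>v x" using v unfolding W_def by blast
    have "snd S g *\<^sub>v v = T *\<^sub>v (snd R g *\<^sub>v x)" using act[OF g x(1)] x(2) by simp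
    then show ?thesis unfolding W_def by (rule image_eqI) (use x Rc[OF g] in auto)
  qed
  ultimately have "W = {0\<^sub>v k} \<or> W = carrier_vec k"
    using S unfolding irreducible_rep_def k_def by blast
  moreover have "W \<noteq> {0\<^sub>v k}"
  proof
    assume W: "W = {0\<^sub>v k}"
    have "carrier_vec n \<subseteq> N" using W unfolding W_def N_def by blast
    then have "carrier_vec n \<subseteq> {0\<^sub>v n :: complex vec}" using N0 by simp
    moreover have "unit_vec n 0 \<in> carrier_vec n" by simp
    ultimately have "unit_vec n 0 = (0\<^sub>v n :: complex vec)" by blast
    then have "unit_vec n 0 $ 0 = (0\<^sub>v n :: complex vec) $ 0" by simp
    then show False using irreducible_pos[OF R] by (simp add: n_def)
  qed
  ultimately have W: "W = carrier_vec k" by blast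
  have "\<exists>u\<in>carrier_vec n. T *\<^sub>v u = unit_vec k i" for i
  proof -
    have "unit_vec k i \<in> W" unfolding W by simp
    then show ?thesis unfolding W_def by auto
  qed
  \<comment> \<open>Chosen preimages of the unit vectors are the columns of a right inverse. That it
    is also a left inverse follows from the injectivity of \<open>T\<close>.\<close>
  then obtain u where u: "\<And>i. u i \<in> carrier_vec n" "\<And>i. T *\<^sub>v u i = unit_vec k i" by metis
  define U where "U = mat n k (\<lambda>(i, j). u j $ i)"
  have U: "U \<in> carrier_mat n k" by (simp add: U_def)
  have TU: "T * U = 1\<^sub>m k"
  proof (rule eq_matI)
    fix i j assume "i < dim_row (1\<^sub>m k :: complex mat)" "j < dim_col (1\<^sub>m k :: complex mat)"
    then have ij: "i < k" "j < k" by auto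
    have "(T * U) $$ (i, j) = (\<Sum>l<n. T $$ (i, l) * U $$ (l, j))"
      by (rule index_mult_sum[OF Tc U ij])
    also have "\<dots> = (\<Sum>l<n. T $$ (i, l) * u j $ l)" using ij by (simp add: U_def)
    also have "\<dots> = (T *\<^sub>v u j) $ i" by (rule index_mult_vec_sum[OF Tc u(1) ij(1), symmetric])
    finally show "(T * U) $$ (i, j) = 1\<^sub>m k $$ (i, j)" using ij u(2) by simp
  qed (use Tc U in auto)
  have "U * T = 1\<^sub>m n"
  proof (rule eq_mat_mult_vecI[of _ n n])
    fix x :: "complex vec" assume x: "x \<in> carrier_vec n"
    define y where "y = (U * T) *\<^sub>v x"
    have y: "y \<in> carrier_vec n" using U Tc x by (auto simp: y_def)
    have "T *\<^sub>v y = (T * U * T) *\<^sub>v x"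
      using U Tc x unfolding y_def by (simp add: mult_vec_assoc_dim)
    also have "\<dots> = T *\<^sub>v x" unfolding TU using Tc by simp
    finally have "T *\<^sub>v (y - x) = 0\<^sub>v k"
      using Tc x y by (simp add: mult_minus_distrib_mat_vec[of _ k n])
    then have "y - x \<in> N" using x y by (simp add: N_def)
    then have yx: "y - x = 0\<^sub>v n" using N0 by simp
    have "y = x"
    proof (rule eq_vecI)
      fix i assume "i < dim_vec x"
      then have i: "i < n" using x by simp
      have "(y - x) $ i = 0" unfolding yx using i by simp
      then show "y $ i = x $ i" using i x y by simp
    qed (use x y in simp)
    then show "(U * T) *\<^sub>v x = 1\<^sub>m n *\<^sub>v x" using x by (simp add: y_def)
  qed (use U Tc in auto)
  then show ?thesis using U TU unfolding n_def k_def by blast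
qed

lemma schur_iso:
  assumes R: "irreducible_rep G R" and S: "irreducible_rep G S" and T: "intertwines G R S T"
    and nz: "T \<noteq> 0\<^sub>m (fst S) (fst R)"
  shows "rep_iso G R S"
  using schur_inverse[OF assms] rep_isoI[OF irreducible_is_rep[OF R] irreducible_is_rep[OF S] T] by blast

text \<open>Over the complex numbers \<open>T\<close> has an eigenvalue \<open>c\<close>. The
  intertwiner \<open>T - c\<close> kills an eigenvector, so it is not invertible and must vanish by
  \<open>schur_inverse\<close>.\<close>

lemma schur_scalar:
  assumes R: "irreducible_rep G R" and T: "intertwines G R R T"
  shows "\<exists>c. T = c \<cdot>\<^sub>m 1\<^sub>m (fst R)"
proof -
  define n where "n = fst R"
  have Tc: "T \<in> carrier_mat n n" and TR: "\<And>g. g \<in> carrier G \<Longrightarrow> T * snd R g = snd R g * T"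
    using T by (simp_all add: intertwines_def n_def)
  note Rc = rep_carrier[OF irreducible_is_rep[OF R], folded n_def]
  have "spectrum T \<noteq> {}" using spectrum_non_empty[OF Tc] irreducible_pos[OF R] by (simp add: n_def)
  then obtain c v where v: "v \<in> carrier_vec n" "v \<noteq> 0\<^sub>v n" "T *\<^sub>v v = c \<cdot>\<^sub>v v"
    using Tc unfolding spectrum_def eigenvalue_def eigenvector_def by auto
  define M where "M = T - c \<cdot>\<^sub>m 1\<^sub>m n"
  have M: "M \<in> carrier_mat n n" unfolding M_def by (rule minus_carrier_mat) simp
  have "M * snd R g = snd R g * M" if g: "g \<in> carrier G" for g
  proof -
    have "M * snd R g = T * snd R g - c \<cdot>\<^sub>m 1\<^sub>m n * snd R g"
      unfolding M_def using Tc Rc[OF g] by (intro minus_mult_distrib_mat[of _ n n]) auto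
    also have "c \<cdot>\<^sub>m 1\<^sub>m n * snd R g = snd R g * (c \<cdot>\<^sub>m 1\<^sub>m n)"
      using Rc[OF g] by (simp add: mult_smult_assoc_mat[of _ n n _ n] mult_smult_distrib[of _ n n _ n])
    also have "T * snd R g - snd R g * (c \<cdot>\<^sub>m 1\<^sub>m n) = snd R g * M"
      unfolding M_def TR[OF g] using Tc Rc[OF g] by (intro mult_minus_distrib_mat[symmetric, of _ n n]) auto
    finally show ?thesis .
  qed
  then have iM: "intertwines G R R M" using M by (simp add: intertwines_def n_def)
  have "M *\<^sub>v v = T *\<^sub>v v - (c \<cdot>\<^sub>m 1\<^sub>m n) *\<^sub>v v"
    unfolding M_def using Tc v by (intro minus_mult_distrib_mat_vec[of _ n n]) auto
  also have "(c \<cdot>\<^sub>m 1\<^sub>m n) *\<^sub>v v = c \<cdot>\<^sub>v v"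
    using v by (intro eq_vecI) (auto simp: scalar_prod_def if_distrib[of "\<lambda>x. c * x"]
        if_distrib[of "\<lambda>x. x * _"] cong: if_cong)
  finally have Mv: "M *\<^sub>v v = 0\<^sub>v n" using v by simp
  have "M = 0\<^sub>m n n"
  proof (rule ccontr)
    assume "M \<noteq> 0\<^sub>m n n"
    then obtain U where U: "U \<in> carrier_mat n n" "U * M = 1\<^sub>m n"
      using schur_inverse[OF R R iM] unfolding n_def by blast
    have "v = (U * M) *\<^sub>v v" unfolding U(2) using v by simp
    also have "\<dots> = U *\<^sub>v 0\<^sub>v n" using U(1) M v(1) Mv by (simp add: mult_vec_assoc_dim)
    also have "\<dots> = 0\<^sub>v n" using U(1) by auto
    finally show False using v by simp
  qed
  then have z: "(T - c \<cdot>\<^sub>m 1\<^sub>m n) $$ (i, j) = 0" if "i < n" "j < n" for i j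
    using that unfolding M_def by simp
  have "T = c \<cdot>\<^sub>m 1\<^sub>m n"
  proof (rule eq_matI)
    fix i j assume "i < dim_row (c \<cdot>\<^sub>m 1\<^sub>m n)" "j < dim_col (c \<cdot>\<^sub>m 1\<^sub>m n)"
    then show "T $$ (i, j) = (c \<cdot>\<^sub>m 1\<^sub>m n) $$ (i, j)" using z[of i j] Tc by auto
  qed (use Tc in auto)
  then show ?thesis unfolding n_def by blast
qed

end

subsection \<open>Traces\<close>

lemma mat_trace_eq: "A \<in> carrier_mat n n \<Longrightarrow> mat_trace A = (\<Sum>i<n. A $$ (i, i))"
  by (simp add: mat_trace_def)

lemma mat_trace_mult_comm:
  assumes A: "A \<in> carrier_mat n m" and B: "B \<in> carrier_mat m n"
  shows "mat_trace (A * B) = mat_trace (B * A)"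
proof -
  have "mat_trace (A * B) = (\<Sum>i<n. \<Sum>j<m. A $$ (i, j) * B $$ (j, i))"
    using A B by (subst mat_trace_eq[of _ n]) (auto simp del: index_mult_mat(1) simp: index_mult_sum[OF A B])
  also have "\<dots> = (\<Sum>j<m. \<Sum>i<n. B $$ (j, i) * A $$ (i, j))"
    by (subst sum.swap) (simp add: mult.commute)
  also have "\<dots> = mat_trace (B * A)"
    using A B by (subst mat_trace_eq[of _ m]) (auto simp del: index_mult_mat(1) simp: index_mult_sum[OF B A])
  finally show ?thesis .
qed

lemma mat_trace_four_block:
  assumes "A \<in> carrier_mat n n" "D \<in> carrier_mat m m"
  shows "mat_trace (four_block_mat A B C D) = mat_trace A + mat_trace D"
proof -
  have "mat_trace (four_block_mat A B C D) = (\<Sum>i<n + m. four_block_mat A B C D $$ (i, i))"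
    using assms by (intro mat_trace_eq) simp
  also have "\<dots> = (\<Sum>i<n + m. if i < n then A $$ (i, i) else D $$ (i - n, i - n))"
    using assms by (intro sum.cong) auto
  also have "\<dots> = (\<Sum>i<n. A $$ (i, i)) + (\<Sum>i<m. D $$ (i, i))"
    by (induction m) (auto intro!: sum.cong)
  finally show ?thesis using assms by (simp add: mat_trace_eq)
qed

lemma mat_trace_msum:
  assumes "\<And>x. x \<in> I \<Longrightarrow> F x \<in> carrier_mat n n"
  shows "mat_trace (msum n n F I) = (\<Sum>x\<in>I. mat_trace (F x))"
proof -
  have "mat_trace (msum n n F I) = (\<Sum>i<n. \<Sum>x\<in>I. F x $$ (i, i))"
    unfolding mat_trace_eq[OF msum_carrier] by (simp add: msum_def)
  also have "\<dots> = (\<Sum>x\<in>I. \<Sum>i<n. F x $$ (i, i))" by (rule sum.swap)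
  also have "\<dots> = (\<Sum>x\<in>I. mat_trace (F x))"
    by (intro sum.cong refl mat_trace_eq[symmetric] assms)
  finally show ?thesis .
qed

text \<open>Left unrestricted, unlike the elements of \<open>irr_chars\<close>; equalities of
  characters are therefore stated pointwise on the carrier.\<close>

definition chr :: "'g rep \<Rightarrow> 'g \<Rightarrow> complex" where
  "chr R g = mat_trace (snd R g)"

context group
begin

lemma chr_eq: "is_rep G R \<Longrightarrow> g \<in> carrier G \<Longrightarrow> chr R g = (\<Sum>i<fst R. snd R g $$ (i, i))"
  unfolding chr_def by (intro mat_trace_eq rep_carrier)

lemma chr_iso:
  assumes R: "is_rep G R" and S: "is_rep G S" and iso: "rep_iso G R S" and g: "g \<in> carrier G"
  shows "chr R g = chr S g"
proof -
  have dim: "fst S = fst R" using rep_isoD(1)[OF iso] ..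
  obtain P Q where P: "P \<in> carrier_mat (fst R) (fst R)" "Q \<in> carrier_mat (fst R) (fst R)"
    "Q * P = 1\<^sub>m (fst R)" "P * Q = 1\<^sub>m (fst R)" and c: "P * snd R g = snd S g * P"
    using rep_isoD(2)[OF iso] g by blast
  note rc = rep_carrier[OF R g] rep_carrier[OF S g, unfolded dim]
  have "snd R g = (Q * P) * snd R g" using P rc by simp
  also have "\<dots> = Q * (snd S g * P)" using P(1,2) rc by (simp add: mult_assoc_dim c)
  finally have "mat_trace (snd R g) = mat_trace (snd S g * P * Q)"
    using P(1,2) rc mat_trace_mult_comm[of Q "fst R" "fst R" "snd S g * P"] by simp
  also have "snd S g * P * Q = snd S g * (P * Q)" using P(1,2) rc by (simp add: mult_assoc_dim)
  also have "\<dots> = snd S g" using P(4) rc by simp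
  finally show ?thesis by (simp add: chr_def)
qed

lemma chr_direct_sum:
  assumes "\<forall>S\<in>set Ss. is_rep G S" and g: "g \<in> carrier G"
  shows "chr (direct_sum_rep Ss) g = (\<Sum>S\<leftarrow>Ss. chr S g)"
  using assms(1)
proof (induction Ss)
  case Nil
  then show ?case by (simp add: chr_def direct_sum_rep_def mat_trace_def)
next
  case (Cons S Ss)
  then have S: "is_rep G S" and Ss: "\<forall>S\<in>set Ss. is_rep G S" by auto
  have "chr (direct_sum_rep (S # Ss)) g = chr S g + chr (direct_sum_rep Ss) g"
    unfolding chr_def direct_sum_rep_Cons(2)[OF S Ss g] unfolding dsum_rep_def snd_conv
    by (rule mat_trace_four_block[OF rep_carrier[OF S g] rep_carrier[OF is_rep_direct_sum[OF Ss] g]])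
  then show ?case using Cons.IH[OF Ss] by simp
qed

end

subsection \<open>Orthogonality\<close>

text \<open>Evaluating the second function at the inverse takes the place of complex conjugation.
  For characters of finite groups the result is the usual inner product, and no unitarity is
  involved in the proofs.\<close>

definition char_ip :: "('g, 'b) monoid_scheme \<Rightarrow> ('g \<Rightarrow> complex) \<Rightarrow> ('g \<Rightarrow> complex) \<Rightarrow> complex" where
  "char_ip K f h = (\<Sum>g\<in>carrier K. f g * h (m_inv K g)) / of_nat (card (carrier K))"

lemma index_mult_elementary:
  fixes A B :: "complex mat"
  assumes A: "A \<in> carrier_mat n n" and B: "B \<in> carrier_mat m m"
    and "i < n" "j < m" "p < n" "q < m"
  shows "(A * mat n m (\<lambda>(a, b). if a = p \<and> b = q then 1 else 0) * B) $$ (i, j) = A $$ (i, p) * B $$ (q, j)"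
proof -
  define E where "E = mat n m (\<lambda>(a, b). if a = p \<and> b = q then 1 else 0 :: complex)"
  have E: "E \<in> carrier_mat n m" by (simp add: E_def)
  have AE: "(A * E) $$ (i, b) = (if b = q then A $$ (i, p) else 0)" if b: "b < m" for b
  proof -
    have "(A * E) $$ (i, b) = (\<Sum>l<n. if l = p then (if b = q then A $$ (i, p) else 0) else 0)"
      unfolding index_mult_sum[OF A E \<open>i < n\<close> b] using b by (intro sum.cong) (auto simp: E_def)
    then show ?thesis using \<open>p < n\<close> by (simp add: sum.delta)
  qed
  have "(A * E * B) $$ (i, j) = (\<Sum>b<m. (A * E) $$ (i, b) * B $$ (b, j))"
    using A E B \<open>i < n\<close> \<open>j < m\<close> by (intro index_mult_sum) auto
  also have "\<dots> = (\<Sum>b<m. if b = q then A $$ (i, p) * B $$ (q, j) else 0)"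
    by (intro sum.cong) (auto simp: AE simp del: index_mult_mat)
  finally show ?thesis using \<open>q < m\<close> by (simp add: E_def sum.delta)
qed

context fin_group
begin

text \<open>Both traces are expanded. The product of the diagonal entries with indices
  \<open>i\<close> and \<open>j\<close> is the entry at \<open>(i, j)\<close> of the product with
  the elementary matrix at \<open>(i, j)\<close> in the middle, which brings Schur's lemma to bear
  on sums of characters.\<close>

lemma sum_chr_eq_average:
  assumes R: "is_rep K R" and S: "is_rep K S"
  shows "(\<Sum>g\<in>carrier K. chr S g * chr R (inv g)) = (\<Sum>i<fst S. \<Sum>j<fst R.
    average K R S (mat (fst S) (fst R) (\<lambda>(a, b). if a = i \<and> b = j then 1 else 0)) $$ (i, j))"
proof -
  have "(\<Sum>g\<in>carrier K. chr S g * chr R (inv g)) =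
      (\<Sum>g\<in>carrier K. \<Sum>i<fst S. \<Sum>j<fst R. snd S g $$ (i, i) * snd R (inv g) $$ (j, j))"
    by (intro sum.cong refl) (simp add: chr_eq[OF R] chr_eq[OF S] sum_product)
  also have "\<dots> = (\<Sum>i<fst S. \<Sum>j<fst R. \<Sum>g\<in>carrier K. snd S g $$ (i, i) * snd R (inv g) $$ (j, j))"
    by (simp add: sum.swap[of _ _ "carrier K"])
  also have "\<dots> = (\<Sum>i<fst S. \<Sum>j<fst R.
    average K R S (mat (fst S) (fst R) (\<lambda>(a, b). if a = i \<and> b = j then 1 else 0)) $$ (i, j))"
    unfolding average_def msum_def
    by (intro sum.cong refl)
      (simp del: index_mult_mat(1) add: index_mult_elementary[OF rep_carrier[OF S] rep_carrier[OF R]])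
  finally show ?thesis .
qed

lemma card_carrier_nonzero: "of_nat (card (carrier K)) \<noteq> (0 :: complex)"
  using finite_carrier by (auto simp: card_eq_0_iff)

lemma char_ip_cong:
  "(\<And>g. g \<in> carrier K \<Longrightarrow> f g = f' g) \<Longrightarrow> (\<And>g. g \<in> carrier K \<Longrightarrow> h g = h' g) \<Longrightarrow>
    char_ip K f h = char_ip K f' h'"
  unfolding char_ip_def by simp

lemma average_trace:
  assumes R: "is_rep K R" and Y: "Y \<in> carrier_mat (fst R) (fst R)"
  shows "mat_trace (average K R R Y) = of_nat (card (carrier K)) * mat_trace Y"
proof -
  have "mat_trace (average K R R Y) = (\<Sum>g\<in>carrier K. mat_trace (snd R g * Y * snd R (inv g)))"
    unfolding average_def using rep_carrier[OF R] Y
    by (intro mat_trace_msum mult_carrier_mat[of _ _ "fst R"]) auto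
  also have "\<dots> = (\<Sum>g\<in>carrier K. mat_trace Y)"
  proof (intro sum.cong refl)
    fix g assume g: "g \<in> carrier K"
    note c = rep_carrier[OF R g] rep_carrier[OF R inv_closed[OF g]]
    have "mat_trace (snd R g * Y * snd R (inv g)) = mat_trace (snd R (inv g) * (snd R g * Y))"
      using c Y by (intro mat_trace_mult_comm[of _ "fst R" "fst R"]) auto
    also have "snd R (inv g) * (snd R g * Y) = snd R (inv g) * snd R g * Y"
      using c Y by (simp add: mult_assoc_dim)
    finally show "mat_trace (snd R g * Y * snd R (inv g)) = mat_trace Y"
      using rep_inv(1)[OF R g] Y by simp
  qed
  finally show ?thesis by simp
qed

text \<open>For isomorphic representations the average of each elementary matrix is a scalar by
  Schur, and its trace determines the scalar: group order over dimension on the diagonal, 0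
  elsewhere. The \<open>n\<close> diagonal terms add up to the group order. For non-isomorphic ones
  every average is a zero intertwiner.\<close>

theorem char_ip_irreducible:
  assumes R: "irreducible_rep K R" and S: "irreducible_rep K S"
  shows "char_ip K (chr R) (chr S) = (if rep_iso K R S then 1 else 0)"
proof (cases "rep_iso K R S")
  case True
  note repR = irreducible_is_rep[OF R] and repS = irreducible_is_rep[OF S]
  define n where "n = fst R"
  define N :: complex where "N = of_nat (card (carrier K))"
  have n: "n > 0" using irreducible_pos[OF R] by (simp add: n_def)
  let ?E = "\<lambda>i j. mat n n (\<lambda>(a, b). if a = i \<and> b = j then 1 else 0 :: complex)"
  have E: "average K R R (?E i j) $$ (i, j) = (if i = j then N / of_nat n else 0)"
    if ij: "i < n" "j < n" for i j
  proof -
    have "intertwines K R R (average K R R (?E i j))"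
      by (rule average_intertwines[OF repR repR]) (simp add: n_def)
    then obtain c where c: "average K R R (?E i j) = c \<cdot>\<^sub>m 1\<^sub>m n"
      using schur_scalar[OF R] unfolding n_def by blast
    have "mat_trace (average K R R (?E i j)) = N * mat_trace (?E i j)"
      unfolding N_def by (rule average_trace[OF repR]) (simp add: n_def)
    also have "mat_trace (?E i j) = (\<Sum>l<n. if l = i then (if i = j then 1 else 0) else 0)"
      unfolding mat_trace_def by (intro sum.cong) auto
    also have "\<dots> = (if i = j then 1 else 0)" using ij by (simp add: sum.delta)
    finally have "of_nat n * c = N * (if i = j then 1 else 0)"
      unfolding c by (simp add: mat_trace_def)
    then have "c = (if i = j then N / of_nat n else 0)" using n by (auto simp: field_simps)
    then show ?thesis unfolding c using ij by simp
  qed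
  have "(\<Sum>g\<in>carrier K. chr R g * chr R (inv g)) = (\<Sum>i<n. \<Sum>j<n. if i = j then N / of_nat n else 0)"
    unfolding sum_chr_eq_average[OF repR repR] n_def[symmetric] using E by (intro sum.cong) auto
  also have "\<dots> = N" using n by (simp add: sum.delta)
  finally have "char_ip K (chr R) (chr R) = 1"
    unfolding char_ip_def using card_carrier_nonzero by (simp add: N_def)
  moreover have "char_ip K (chr R) (chr S) = char_ip K (chr R) (chr R)"
    using chr_iso[OF repR repS True] by (intro char_ip_cong) auto
  ultimately show ?thesis using True by simp
next
  case False
  note repR = irreducible_is_rep[OF R] and repS = irreducible_is_rep[OF S]
  have not: "\<not> rep_iso K S R" using rep_iso_sym[OF repS repR] False by blast
  have z: "average K S R Y = 0\<^sub>m (fst R) (fst S)" if "Y \<in> carrier_mat (fst R) (fst S)" for Y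
    using schur_iso[OF S R average_intertwines[OF repS repR that]] not by blast
  have "(\<Sum>g\<in>carrier K. chr R g * chr S (inv g)) = 0"
    unfolding sum_chr_eq_average[OF repS repR] by (intro sum.neutral ballI) (simp add: z)
  then show ?thesis using False by (simp add: char_ip_def)
qed

lemma char_ip_direct_sum:
  assumes "\<forall>S\<in>set Ss. is_rep K S"
  shows "char_ip K (chr (direct_sum_rep Ss)) h = (\<Sum>S\<leftarrow>Ss. char_ip K (chr S) h)"
proof -
  have "char_ip K (chr (direct_sum_rep Ss)) h = char_ip K (\<lambda>g. \<Sum>S\<leftarrow>Ss. chr S g) h"
    by (intro char_ip_cong chr_direct_sum[OF assms]) auto
  also have "\<dots> = (\<Sum>S\<leftarrow>Ss. char_ip K (chr S) h)"
    by (induction Ss) (auto simp: char_ip_def distrib_right sum.distrib add_divide_distrib)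
  finally show ?thesis .
qed

lemma char_ip_decomposition:
  assumes R: "is_rep K R" and C: "C \<in> irr_classes K" and Cs: "set Cs \<subseteq> irr_classes K"
    and iso: "rep_iso K R (direct_sum_rep (map class_rep Cs))"
  shows "char_ip K (chr R) (chr (class_rep C)) = of_nat (count_list Cs C)"
proof -
  have reps: "\<forall>S\<in>set (map class_rep Cs). is_rep K S"
    using Cs by (auto intro!: irreducible_is_rep irreducible_class_rep)
  have "char_ip K (chr R) (chr (class_rep C)) =
      char_ip K (chr (direct_sum_rep (map class_rep Cs))) (chr (class_rep C))"
    by (intro char_ip_cong chr_iso[OF R is_rep_direct_sum[OF reps] iso]) auto
  also have "\<dots> = (\<Sum>D\<leftarrow>Cs. char_ip K (chr (class_rep D)) (chr (class_rep C)))"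
    unfolding char_ip_direct_sum[OF reps] by (simp add: o_def)
  also have "\<dots> = of_nat (count_list Cs C)"
    using Cs
  proof (induction Cs)
    case (Cons D Cs)
    then show ?case
      using C by (simp add: char_ip_irreducible irreducible_class_rep rep_iso_class_rep_iff)
  qed simp
  finally show ?thesis .
qed

text \<open>This justifies the definite description in \<open>irr_mult\<close>: complete
  reducibility provides one list, and the pairing fixes the count for every admissible list, which
  here replaces Krull-Schmidt. All later statements on multiplicities pass through this
  formula.\<close>

theorem of_nat_irr_mult:
  assumes R: "is_rep K R" and C: "C \<in> irr_classes K"
  shows "of_nat (irr_mult K R C) = char_ip K (chr R) (chr (class_rep C))"
proof -
  obtain Cs where Cs: "set Cs \<subseteq> irr_classes K" "rep_iso K R (direct_sum_rep (map class_rep Cs))"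
    using complete_reducibility[OF R] by blast
  have "irr_mult K R C = count_list Cs C"
    unfolding irr_mult_def
  proof (rule the_equality)
    fix k assume "\<exists>Cs. set Cs \<subseteq> irr_classes K \<and>
      rep_iso K R (direct_sum_rep (map class_rep Cs)) \<and> k = count_list Cs C"
    then have "of_nat k = char_ip K (chr R) (chr (class_rep C))"
      using char_ip_decomposition[OF R C] by auto
    then show "k = count_list Cs C" using char_ip_decomposition[OF R C Cs] by simp
  qed (use Cs in blast)
  then show ?thesis using char_ip_decomposition[OF R C Cs] by simp
qed

end

section \<open>Characters determine irreducible representations\<close>

context fin_group
begin

text \<open>An invariant subspace of \<open>R\<close> is carried by \<open>P\<close> to an invariant
  subspace of \<open>S\<close>, and \<open>Q\<close> brings the two possible answers back.\<close>

lemma irreducible_iso: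
  assumes R: "is_rep K R" and S: "irreducible_rep K S" and iso: "rep_iso K R S"
  shows "irreducible_rep K R"
proof -
  define n where "n = fst R"
  have dim: "fst S = n" using rep_isoD(1)[OF iso] by (simp add: n_def)
  obtain P Q where P: "P \<in> carrier_mat n n" "Q \<in> carrier_mat n n" "Q * P = 1\<^sub>m n" "P * Q = 1\<^sub>m n"
    and c: "\<And>g. g \<in> carrier K \<Longrightarrow> P * snd R g = snd S g * P"
    using rep_isoD(2)[OF iso] unfolding n_def by blast
  note Rc = rep_carrier[OF R, folded n_def]
    and Sc = rep_carrier[OF irreducible_is_rep[OF S], unfolded dim]
  have QP: "Q *\<^sub>v (P *\<^sub>v v) = v" if "v \<in> carrier_vec n" for v
    using assoc_mult_mat_vec[OF P(2,1) that] P(3) that by simp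
  have PQ: "P *\<^sub>v (Q *\<^sub>v v) = v" if "v \<in> carrier_vec n" for v
    using assoc_mult_mat_vec[OF P(1,2) that] P(4) that by simp
  have "W = {0\<^sub>v n} \<or> W = carrier_vec n"
    if W: "VectorSpace.subspace class_ring W (module_vec TYPE(complex) n)"
      and inv: "\<forall>g\<in>carrier K. \<forall>v\<in>W. snd R g *\<^sub>v v \<in> W" for W
  proof -
    have Wc: "W \<subseteq> carrier_vec n" and W0: "0\<^sub>v n \<in> W" and Wadd: "\<And>v w. v \<in> W \<Longrightarrow> w \<in> W \<Longrightarrow> v + w \<in> W"
      and Wsm: "\<And>c v. v \<in> W \<Longrightarrow> c \<cdot>\<^sub>v v \<in> W"
      using W unfolding subspace_module_vec_iff by auto
    define W' where "W' = (\<lambda>v. P *\<^sub>v v) ` W"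
    have "VectorSpace.subspace class_ring W' (module_vec TYPE(complex) n)"
      unfolding subspace_module_vec_iff
    proof (intro conjI ballI allI)
      show "W' \<subseteq> carrier_vec n" using P Wc unfolding W'_def by auto
      have "0\<^sub>v n = P *\<^sub>v 0\<^sub>v n" using P by auto
      then show "0\<^sub>v n \<in> W'" unfolding W'_def by (rule image_eqI) (rule W0)
    next
      fix v w assume "v \<in> W'" "w \<in> W'"
      then obtain x y where x: "x \<in> W" "v = P *\<^sub>v x" "y \<in> W" "w = P *\<^sub>v y"
        unfolding W'_def by blast
      then have "v + w = P *\<^sub>v (x + y)"
        using P(1) subsetD[OF Wc, of x] subsetD[OF Wc, of y] by (simp add: mult_add_distrib_mat_vec[of _ n n])
      then show "v + w \<in> W'" unfolding W'_def by (rule image_eqI) (use x Wadd in simp)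
    next
      fix c v assume "v \<in> W'"
      then obtain x where x: "x \<in> W" "v = P *\<^sub>v x" unfolding W'_def by blast
      then have "c \<cdot>\<^sub>v v = P *\<^sub>v (c \<cdot>\<^sub>v x)" using P(1) subsetD[OF Wc, of x] by (simp add: mult_mat_vec[of _ n n])
      then show "c \<cdot>\<^sub>v v \<in> W'" unfolding W'_def by (rule image_eqI) (use x Wsm in simp)
    qed
    moreover have "snd S g *\<^sub>v v \<in> W'" if g: "g \<in> carrier K" and v: "v \<in> W'" for g v
    proof -
      obtain x where x: "x \<in> W" "v = P *\<^sub>v x" using v unfolding W'_def by blast
      have xc: "x \<in> carrier_vec n" using x Wc by blast
      have "snd S g *\<^sub>v v = (snd S g * P) *\<^sub>v x" using assoc_mult_mat_vec[OF Sc[OF g] P(1) xc] x by simp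
      also have "\<dots> = P *\<^sub>v (snd R g *\<^sub>v x)"
        unfolding c[OF g, symmetric] using assoc_mult_mat_vec[OF P(1) Rc[OF g] xc] by simp
      finally show ?thesis unfolding W'_def by (rule image_eqI) (use x inv g in blast)
    qed
    ultimately have "W' = {0\<^sub>v n} \<or> W' = carrier_vec n"
      using S unfolding irreducible_rep_def dim by blast
    then show ?thesis
    proof
      assume W': "W' = {0\<^sub>v n}"
      have "v = 0\<^sub>v n" if v: "v \<in> W" for v
      proof -
        have "P *\<^sub>v v = 0\<^sub>v n" using v W' unfolding W'_def by blast
        then have "v = Q *\<^sub>v 0\<^sub>v n" using QP[of v] v Wc by auto
        also have "\<dots> = 0\<^sub>v n" using P(2) by auto
        finally show ?thesis .
      qed
      then show ?thesis using W0 by blast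
    next
      assume W': "W' = carrier_vec n"
      have "v \<in> W" if v: "v \<in> carrier_vec n" for v
      proof -
        have "P *\<^sub>v v \<in> W'" unfolding W' using P(1) v by simp
        then obtain w where w: "w \<in> W" "P *\<^sub>v v = P *\<^sub>v w" unfolding W'_def by blast
        then have "v = w" using QP[OF v] QP[of w] Wc by auto
        then show ?thesis using w by simp
      qed
      then show ?thesis using Wc by blast
    qed
  qed
  then show ?thesis using R irreducible_pos[OF S] dim unfolding irreducible_rep_def n_def by auto
qed

text \<open>The character fixes the multiplicities of \<open>R\<close>: one for the class of
  \<open>S\<close>, zero for every other, so the decomposition is a one-element list. Irreducibility
  is assumed of \<open>S\<close> alone because \<open>R\<close> will be a restriction whose
  irreducibility is still to be shown.\<close>

lemma rep_iso_if_chr_eq: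
  assumes R: "is_rep K R" and S: "irreducible_rep K S"
    and eq: "\<And>g. g \<in> carrier K \<Longrightarrow> chr R g = chr S g"
  shows "rep_iso K R S"
proof -
  obtain Cs where Cs: "set Cs \<subseteq> irr_classes K" and iso: "rep_iso K R (direct_sum_rep (map class_rep Cs))"
    using complete_reducibility[OF R] by blast
  define D where "D = irr_class K S"
  have D: "D \<in> irr_classes K" using S by (simp add: D_def irr_class_in_classes)
  have repD: "irreducible_rep K (class_rep D)" "rep_iso K S (class_rep D)"
    using class_rep_irr_class[OF S] by (simp_all add: D_def)
  have count: "count_list Cs C = (if C = D then 1 else 0)" if C: "C \<in> irr_classes K" for C
  proof -
    have "of_nat (count_list Cs C) = char_ip K (chr S) (chr (class_rep C))"
      unfolding char_ip_decomposition[OF R C Cs iso, symmetric] by (intro char_ip_cong eq) auto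
    also have "\<dots> = char_ip K (chr (class_rep D)) (chr (class_rep C))"
      by (rule char_ip_cong[OF chr_iso refl]) (use S repD in \<open>auto intro: irreducible_is_rep\<close>)
    finally have "of_nat (count_list Cs C) = (if C = D then 1 else 0 :: complex)"
      using C D by (auto simp: char_ip_irreducible irreducible_class_rep rep_iso_class_rep_iff)
    then show ?thesis by (auto split: if_splits)
  qed
  have "C = D" if C: "C \<in> set Cs" for C
    using C Cs count[of C] count_list_0_iff[of Cs C] by (auto split: if_splits)
  then have sub: "set Cs \<subseteq> {D}" by blast
  have "length Cs = 1"
  proof -
    have "filter ((=) D) Cs = Cs" using sub by (intro filter_True) auto
    then show ?thesis using count[OF D] by (simp add: count_list_eq_length_filter)
  qed
  then have "Cs = [D]" using sub by (cases Cs) auto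
  then have "rep_iso K R (direct_sum_rep [class_rep D])" using iso by simp
  moreover have "direct_sum_rep [class_rep D] = class_rep D"
    by (simp add: direct_sum_rep_def del: diag_block_mat.simps)
  ultimately have "rep_iso K R (class_rep D)" by simp
  moreover have "rep_iso K (class_rep D) S"
    by (rule rep_iso_sym[OF irreducible_is_rep[OF S] irreducible_is_rep[OF repD(1)] repD(2)])
  ultimately show ?thesis
    by (rule rep_iso_trans[OF R irreducible_is_rep[OF repD(1)] irreducible_is_rep[OF S]])
qed

lemma rep_has_irreducible_constituent:
  assumes R: "is_rep K R" and pos: "fst R > 0"
  shows "\<exists>S. irreducible_rep K S \<and> char_ip K (chr R) (chr S) \<noteq> 0"
proof -
  obtain Cs where Cs: "set Cs \<subseteq> irr_classes K" and iso: "rep_iso K R (direct_sum_rep (map class_rep Cs))"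
    using complete_reducibility[OF R] by blast
  have "Cs \<noteq> []" using rep_isoD(1)[OF iso] pos by (auto simp: direct_sum_rep_def)
  then obtain C where C: "C \<in> set Cs" by (cases Cs) auto
  then have "count_list Cs C \<noteq> 0" by (simp add: count_list_0_iff)
  then have "char_ip K (chr R) (chr (class_rep C)) \<noteq> 0"
    using char_ip_decomposition[OF R _ Cs iso] C Cs by auto
  then show ?thesis using C Cs irreducible_class_rep by blast
qed

end

section \<open>Restriction to a normal subgroup with cyclic quotient\<close>

lemma smult_smult_eq: "a \<cdot>\<^sub>m (c \<cdot>\<^sub>m A) = (a * c) \<cdot>\<^sub>m (A :: complex mat)"
  by (intro eq_matI) auto

text \<open>The pairing \<open>b\<close> is perfect: \<open>x \<mapsto> b x\<close> identifies the quotient with its group of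
  linear characters.\<close>

locale bicharacter_quotient = fin_group G + normal L G for L and G (structure) +
  fixes b :: "'a set \<Rightarrow> 'a set \<Rightarrow> complex"
  assumes b_mult_left: "\<lbrakk>x \<in> carrier (G Mod L); y \<in> carrier (G Mod L); z \<in> carrier (G Mod L)\<rbrakk> \<Longrightarrow>
      b (x \<otimes>\<^bsub>G Mod L\<^esub> y) z = b x z * b y z"
    and b_mult_right: "\<lbrakk>x \<in> carrier (G Mod L); y \<in> carrier (G Mod L); z \<in> carrier (G Mod L)\<rbrakk> \<Longrightarrow>
      b x (y \<otimes>\<^bsub>G Mod L\<^esub> z) = b x y * b x z"
    and b_nonzero: "\<lbrakk>x \<in> carrier (G Mod L); y \<in> carrier (G Mod L)\<rbrakk> \<Longrightarrow> b x y \<noteq> 0"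
    and b_orthogonal: "z \<in> carrier (G Mod L) \<Longrightarrow>
      (\<Sum>x\<in>carrier (G Mod L). b x z) = (if z = L then of_nat (card (carrier (G Mod L))) else 0)"
    and extends: "\<And>S. irreducible_rep (G\<lparr>carrier := L\<rparr>) S \<Longrightarrow>
      \<exists>R. irreducible_rep G R \<and> (\<forall>g\<in>L. chr R g = chr S g)"
begin

abbreviation "Q \<equiv> G Mod L"
abbreviation "H \<equiv> G\<lparr>carrier := L\<rparr>"

lemma group_Q: "group Q"
  by (rule factorgroup_is_group)

lemma coset_carrier: "g \<in> carrier G \<Longrightarrow> L #> g \<in> carrier Q"
  by (simp add: carrier_FactGroup)

lemma coset_mult: "g \<in> carrier G \<Longrightarrow> h \<in> carrier G \<Longrightarrow> L #> (g \<otimes> h) = (L #> g) \<otimes>\<^bsub>Q\<^esub> (L #> h)"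
  by (simp add: rcos_sum)

lemma L_in_Q: "L \<in> carrier Q"
  using monoid.one_closed[OF group.is_monoid[OF group_Q]] by simp

lemma coset_eq_L_iff: "g \<in> carrier G \<Longrightarrow> L #> g = L \<longleftrightarrow> g \<in> L"
  using coset_join1 coset_join2 subgroup_axioms by blast

lemma finite_Q: "finite (carrier Q)"
  by (simp add: carrier_FactGroup finite_carrier)

lemma b_one_right: "x \<in> carrier Q \<Longrightarrow> b x L = 1"
  using b_mult_right[of x L L] b_nonzero[of x L] L_in_Q monoid.l_one[OF group.is_monoid[OF group_Q] L_in_Q]
  by simp

lemma b_one_left: "x \<in> carrier Q \<Longrightarrow> b L x = 1"
  using b_mult_left[of L L x] b_nonzero[of L x] L_in_Q monoid.l_one[OF group.is_monoid[OF group_Q] L_in_Q]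
  by simp

lemma b_inv:
  assumes "x \<in> carrier Q" "g \<in> carrier G"
  shows "b x (L #> inv g) * b x (L #> g) = 1"
proof -
  have "b x (L #> inv g) * b x (L #> g) = b x ((L #> inv g) \<otimes>\<^bsub>Q\<^esub> (L #> g))"
    using assms by (simp add: b_mult_right coset_carrier del: mult_FactGroup)
  also have "\<dots> = b x (L #> (inv g \<otimes> g))"
    by (simp only: coset_mult[OF inv_closed[OF assms(2)] assms(2)])
  also have "\<dots> = 1" using assms b_one_right coset_eq_L_iff[of \<one>] by simp
  finally show ?thesis .
qed

text \<open>The tensor product of \<open>R\<close> with the linear character \<open>b x\<close> of
  the quotient, inflated to \<open>G\<close>.\<close>

definition twist :: "'a set \<Rightarrow> 'a rep \<Rightarrow> 'a rep" where
  "twist x R = (fst R, \<lambda>g. b x (L #> g) \<cdot>\<^sub>m snd R g)"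

lemma fst_twist [simp]: "fst (twist x R) = fst R"
  by (simp add: twist_def)

lemma is_rep_twist:
  assumes R: "is_rep G R" and x: "x \<in> carrier Q"
  shows "is_rep G (twist x R)"
  unfolding is_rep_iff twist_def fst_conv snd_conv
proof (intro conjI ballI)
  fix g h assume g: "g \<in> carrier G" and h: "h \<in> carrier G"
  show "b x (L #> g) \<cdot>\<^sub>m snd R g \<in> carrier_mat (fst R) (fst R)" using rep_carrier[OF R g] by simp
  show "b x (L #> (g \<otimes> h)) \<cdot>\<^sub>m snd R (g \<otimes> h) = b x (L #> g) \<cdot>\<^sub>m snd R g * (b x (L #> h) \<cdot>\<^sub>m snd R h)"
    using g h x rep_carrier[OF R g] rep_carrier[OF R h]
    by (simp add: coset_mult b_mult_right coset_carrier rep_mult[OF R] smult_smult_eq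
        mult_smult_assoc_mat[of _ "fst R" "fst R" _ "fst R"] mult_smult_distrib[of _ "fst R" "fst R" _ "fst R"]
        mult.commute del: mult_FactGroup)
next
  show "b x (L #> \<one>) \<cdot>\<^sub>m snd R \<one> = 1\<^sub>m (fst R)"
    using coset_eq_L_iff[of \<one>] b_one_right[OF x] rep_one[OF R] by (intro eq_matI) auto
qed

text \<open>The values of the two representations differ by nonzero scalars, so they have the same
  invariant subspaces.\<close>

lemma irreducible_twist:
  assumes R: "irreducible_rep G R" and x: "x \<in> carrier Q"
  shows "irreducible_rep G (twist x R)"
  unfolding irreducible_rep_def fst_twist
proof (intro conjI allI impI)
  show "is_rep G (twist x R)" "fst R > 0"
    using is_rep_twist irreducible_is_rep irreducible_pos R x by blast+
next
  fix W assume W: "VectorSpace.subspace class_ring W (module_vec TYPE(complex) (fst R)) \<and>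
    (\<forall>g\<in>carrier G. \<forall>v\<in>W. snd (twist x R) g *\<^sub>v v \<in> W)"
  have "snd R g *\<^sub>v v \<in> W" if g: "g \<in> carrier G" and v: "v \<in> W" for g v
  proof -
    define c where "c = b x (L #> g)"
    have c: "c \<noteq> 0" using b_nonzero x g coset_carrier by (simp add: c_def)
    have vc: "v \<in> carrier_vec (fst R)" using W v unfolding subspace_module_vec_iff by blast
    have "(c \<cdot>\<^sub>m snd R g) *\<^sub>v v \<in> W" using W g v by (simp add: twist_def c_def)
    then have "(1 / c) \<cdot>\<^sub>v ((c \<cdot>\<^sub>m snd R g) *\<^sub>v v) \<in> W" using W unfolding subspace_module_vec_iff by blast
    also have "(1 / c) \<cdot>\<^sub>v ((c \<cdot>\<^sub>m snd R g) *\<^sub>v v) = snd R g *\<^sub>v v"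
      using rep_carrier[OF irreducible_is_rep[OF R] g] vc c
      by (intro eq_vecI) (auto simp: scalar_prod_def sum_distrib_left)
    finally show ?thesis .
  qed
  then show "W = {0\<^sub>v (fst R)} \<or> W = carrier_vec (fst R)"
    using R W unfolding irreducible_rep_def by blast
qed

lemma chr_twist: "is_rep G R \<Longrightarrow> g \<in> carrier G \<Longrightarrow> chr (twist x R) g = b x (L #> g) * chr R g"
  using rep_dim[of R g] by (simp add: chr_def mat_trace_def twist_def sum_distrib_left)

lemma fin_group_H: "fin_group H"
  using subgroup_is_group[OF is_group] subset finite_carrier
  by (simp add: fin_group_def fin_group_axioms_def finite_subset)

lemma is_rep_H: "is_rep G R \<Longrightarrow> is_rep H R"
  unfolding is_rep_def hom_def using subset by auto

text \<open>Frobenius reciprocity, with the induced representation of the restriction of \<open>R\<close>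
  replaced by the sum of the twists of \<open>R\<close>.\<close>

lemma sum_char_ip_twist:
  assumes R: "is_rep G R"
  shows "(\<Sum>x\<in>carrier Q. char_ip G f (chr (twist x R))) = char_ip H f (chr R)"
proof -
  define q where "q = (of_nat (card (carrier Q)) :: complex)"
  have "card (carrier Q) * card L = card (carrier G)"
    using lagrange_finite[OF finite_carrier subgroup_axioms] by (simp add: FactGroup_def Coset.order_def)
  then have card: "of_nat (card (carrier G)) = q * of_nat (card L)"
    unfolding q_def by (metis of_nat_mult)
  have q: "q \<noteq> 0" using finite_Q L_in_Q by (auto simp: q_def card_eq_0_iff)
  have "(\<Sum>x\<in>carrier Q. \<Sum>g\<in>carrier G. f g * chr (twist x R) (inv g)) =
      (\<Sum>g\<in>carrier G. f g * chr R (inv g) * (\<Sum>x\<in>carrier Q. b x (L #> inv g)))"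
    by (subst sum.swap) (simp add: chr_twist[OF R] sum_distrib_left mult_ac)
  \<comment> \<open>Orthogonality of the pairing: summing \<open>b x\<close> over \<open>x\<close>
    at the coset of \<open>inv g\<close> gives \<open>q\<close> when \<open>g\<close> lies in
    \<open>L\<close> and 0 otherwise. The factor \<open>q\<close> later cancels, since the order of
    \<open>G\<close> is \<open>q\<close> times that of \<open>L\<close>.\<close>
  also have "\<dots> = (\<Sum>g\<in>carrier G. if g \<in> L then q * (f g * chr R (inv g)) else 0)"
  proof (intro sum.cong refl)
    fix g assume g: "g \<in> carrier G"
    have "L #> inv g = L \<longleftrightarrow> g \<in> L"
      using g coset_eq_L_iff[of "inv g"] m_inv_closed[of g] m_inv_closed[of "inv g"] by auto
    then show "f g * chr R (inv g) * (\<Sum>x\<in>carrier Q. b x (L #> inv g)) =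
        (if g \<in> L then q * (f g * chr R (inv g)) else 0)"
      using b_orthogonal[of "L #> inv g"] coset_carrier[of "inv g"] g by (simp add: q_def)
  qed
  also have "\<dots> = (\<Sum>g\<in>L. q * (f g * chr R (inv g)))"
    using finite_carrier subset by (intro sum.mono_neutral_cong_right) auto
  also have "\<dots> = q * (\<Sum>g\<in>L. f g * chr R (inv\<^bsub>H\<^esub> g))"
    by (simp add: sum_distrib_left m_inv_consistent[OF subgroup_axioms])
  finally show ?thesis
    using q by (simp add: char_ip_def card sum_divide_distrib[symmetric])
qed

lemma chr_twist_L:
  assumes "is_rep G R" "x \<in> carrier Q" "g \<in> L"
  shows "chr (twist x R) g = chr R g"
  using assms subset coset_eq_L_iff[of g] by (simp add: chr_twist b_one_right subsetD)

text \<open>A nonzero pairing over \<open>L\<close> is a sum of pairings over \<open>G\<close> with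
  the twists of \<open>S\<close>, so one of these is nonzero; both sides being irreducible, it comes
  from an isomorphism.\<close>

lemma twist_iso_exists:
  assumes R: "irreducible_rep G R" and S: "irreducible_rep G S" and nz: "char_ip H (chr R) (chr S) \<noteq> 0"
  shows "\<exists>x\<in>carrier Q. rep_iso G R (twist x S)"
proof -
  obtain x where x: "x \<in> carrier Q" "char_ip G (chr R) (chr (twist x S)) \<noteq> 0"
    using nz unfolding sum_char_ip_twist[OF irreducible_is_rep[OF S], symmetric]
    by (meson sum.neutral)
  then have "rep_iso G R (twist x S)"
    using char_ip_irreducible[OF R irreducible_twist[OF S x(1)]] by (auto split: if_splits)
  then show ?thesis using x(1) by blast
qed

text \<open>Let \<open>S\<close> be a constituent of \<open>R\<close> on \<open>L\<close>, and
  \<open>R'\<close> an extension of its character. Then \<open>R\<close> pairs nontrivially with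
  \<open>R'\<close> over \<open>L\<close>, hence is a twist of \<open>R'\<close>. Twisting is
  invisible on \<open>L\<close>, so there \<open>R\<close> has the character of the irreducible
  \<open>S\<close>.\<close>

theorem irreducible_restrict:
  assumes R: "irreducible_rep G R"
  shows "irreducible_rep H R"
proof -
  interpret H: fin_group H by (rule fin_group_H)
  note repR = irreducible_is_rep[OF R]
  obtain S where S: "irreducible_rep H S" and nz: "char_ip H (chr R) (chr S) \<noteq> 0"
    using H.rep_has_irreducible_constituent[OF is_rep_H[OF repR] irreducible_pos[OF R]] by blast
  obtain R' where R': "irreducible_rep G R'" and eq: "\<And>g. g \<in> L \<Longrightarrow> chr R' g = chr S g"
    using extends[OF S] by blast
  have "char_ip H (chr R) (chr R') = char_ip H (chr R) (chr S)"
    using eq by (intro H.char_ip_cong) auto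
  then obtain x where x: "x \<in> carrier Q" and iso: "rep_iso G R (twist x R')"
    using twist_iso_exists[OF R R'] nz by auto
  have "chr R g = chr S g" if g: "g \<in> L" for g
  proof -
    have "chr R g = chr (twist x R') g"
      using g subset by (intro chr_iso repR is_rep_twist irreducible_is_rep R' x iso) auto
    then show ?thesis using chr_twist_L[OF irreducible_is_rep[OF R'] x g] eq[OF g] by simp
  qed
  then have "rep_iso H R S" by (intro H.rep_iso_if_chr_eq is_rep_H repR S) simp
  then show ?thesis by (rule H.irreducible_iso[OF is_rep_H[OF repR] S])
qed

lemma twist_transitive:
  assumes R: "irreducible_rep G R" and S: "irreducible_rep G S" and iso: "rep_iso H R S"
  shows "\<exists>x\<in>carrier Q. rep_iso G R (twist x S)"
proof (rule twist_iso_exists[OF R S])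
  interpret H: fin_group H by (rule fin_group_H)
  show "char_ip H (chr R) (chr S) \<noteq> 0"
    using H.char_ip_irreducible[OF irreducible_restrict[OF R] irreducible_restrict[OF S]] iso by simp
qed

text \<open>The pairing of \<open>R\<close> with itself over \<open>L\<close> is 1 by
  irreducibility, and it also counts the \<open>x\<close> with \<open>R\<close> isomorphic to
  \<open>twist x R\<close>. The unit \<open>L\<close> of the quotient is one such \<open>x\<close>,
  so it is the only one.\<close>

lemma twist_free:
  assumes R: "irreducible_rep G R" and x: "x \<in> carrier Q" and iso: "rep_iso G R (twist x R)"
  shows "x = L"
proof (rule ccontr)
  assume ne: "x \<noteq> L"
  interpret H: fin_group H by (rule fin_group_H)
  have irr: "irreducible_rep H R" by (rule irreducible_restrict[OF R])
  let ?I = "\<lambda>x. rep_iso G R (twist x R)"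
  have self: "rep_iso H R R" using irr H.rep_carrier irreducible_is_rep by (intro rep_iso_refl) blast
  have L: "?I L"
    using b_one_left coset_carrier irreducible_is_rep[OF R] L_in_Q
    by (intro rep_iso_if_chr_eq irreducible_twist R) (auto simp: chr_twist)
  have "(1 :: complex) = char_ip H (chr R) (chr R)"
    using H.char_ip_irreducible[OF irr irr] self by simp
  also have "\<dots> = (\<Sum>y\<in>carrier Q. if ?I y then 1 else 0)"
    unfolding sum_char_ip_twist[OF irreducible_is_rep[OF R], symmetric]
    by (intro sum.cong refl char_ip_irreducible R irreducible_twist)
  also have "\<dots> = of_nat (card {y \<in> carrier Q. ?I y})"
    using finite_Q by (simp add: sum.If_cases Int_def)
  finally have "card {y \<in> carrier Q. ?I y} = 1" using of_nat_eq_1_iff by metis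
  moreover have "card {x, L} \<le> card {y \<in> carrier Q. ?I y}"
    by (rule card_mono) (use finite_Q x L iso L_in_Q in auto)
  ultimately have "card {x, L} \<le> 1" by simp
  then show False using ne by simp
qed

end

section \<open>Tensor products\<close>

lemma sum_lessThan_add: "(\<Sum>l<k + m. F l) = (\<Sum>l<k. F l) + (\<Sum>l<m. F (k + l :: nat) :: complex)"
  by (induction m) (simp_all add: add.assoc)

text \<open>The indexing of \<open>kronecker\<close>: an index below \<open>n * m\<close> encodes
  the pair of its quotient and remainder modulo \<open>m\<close>.\<close>

lemma sum_div_mod:
  fixes F :: "nat \<Rightarrow> nat \<Rightarrow> complex"
  assumes "m > 0"
  shows "(\<Sum>l<n * m. F (l div m) (l mod m)) = (\<Sum>a<n. \<Sum>b<m. F a b)"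
proof (induction n)
  case (Suc n)
  have "(\<Sum>b<m. F ((n * m + b) div m) ((n * m + b) mod m)) = (\<Sum>b<m. F n b)"
    by (intro sum.cong) auto
  then show ?case using Suc by (simp add: add.commute[of m] sum_lessThan_add)
qed simp

lemma kronecker_carrier:
  "A \<in> carrier_mat n n \<Longrightarrow> B \<in> carrier_mat m m \<Longrightarrow> kronecker A B \<in> carrier_mat (n * m) (n * m)"
  unfolding kronecker_def by auto

lemma index_kronecker:
  assumes "A \<in> carrier_mat n n" "B \<in> carrier_mat m m" "i < n * m" "j < n * m"
  shows "kronecker A B $$ (i, j) = A $$ (i div m, j div m) * B $$ (i mod m, j mod m)"
  using assms unfolding kronecker_def by auto

lemma kronecker_mult:
  assumes A: "A \<in> carrier_mat n n" and B: "B \<in> carrier_mat m m"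
    and C: "C \<in> carrier_mat n n" and D: "D \<in> carrier_mat m m"
  shows "kronecker A B * kronecker C D = kronecker (A * C) (B * D)"
proof (rule eq_matI)
  have AC: "A * C \<in> carrier_mat n n" and BD: "B * D \<in> carrier_mat m m" using A B C D by auto
  fix i j assume "i < dim_row (kronecker (A * C) (B * D))" "j < dim_col (kronecker (A * C) (B * D))"
  then have ij: "i < n * m" "j < n * m" using kronecker_carrier[OF AC BD] by auto
  then have m: "m > 0" by (cases m) auto
  then have d: "i div m < n" "j div m < n" "i mod m < m" "j mod m < m"
    using ij by (auto simp: less_mult_imp_div_less)
  have "(kronecker A B * kronecker C D) $$ (i, j) =
      (\<Sum>l<n * m. kronecker A B $$ (i, l) * kronecker C D $$ (l, j))"
    using ij by (rule index_mult_sum[OF kronecker_carrier[OF A B] kronecker_carrier[OF C D]])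
  also have "\<dots> = (\<Sum>l<n * m. (A $$ (i div m, l div m) * C $$ (l div m, j div m)) *
      (B $$ (i mod m, l mod m) * D $$ (l mod m, j mod m)))"
    using ij by (intro sum.cong refl) (simp add: index_kronecker[OF A B] index_kronecker[OF C D])
  also have "\<dots> = (\<Sum>a<n. \<Sum>b<m. (A $$ (i div m, a) * C $$ (a, j div m)) *
      (B $$ (i mod m, b) * D $$ (b, j mod m)))"
    by (rule sum_div_mod[OF m])
  also have "\<dots> = (A * C) $$ (i div m, j div m) * (B * D) $$ (i mod m, j mod m)"
    unfolding index_mult_sum[OF A C d(1,2)] index_mult_sum[OF B D d(3,4)] by (simp add: sum_product)
  also have "\<dots> = kronecker (A * C) (B * D) $$ (i, j)" by (rule index_kronecker[OF AC BD ij, symmetric])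
  finally show "(kronecker A B * kronecker C D) $$ (i, j) = kronecker (A * C) (B * D) $$ (i, j)" .
qed (use A B C D in \<open>auto simp: kronecker_def\<close>)

lemma kronecker_one: "kronecker (1\<^sub>m n) (1\<^sub>m m) = 1\<^sub>m (n * m)"
proof (rule eq_matI)
  fix i j assume "i < dim_row (1\<^sub>m (n * m) :: complex mat)" "j < dim_col (1\<^sub>m (n * m) :: complex mat)"
  then have ij: "i < n * m" "j < n * m" by auto
  then have m: "m > 0" by (cases m) auto
  have "i = j \<longleftrightarrow> i div m = j div m \<and> i mod m = j mod m" by (metis div_mult_mod_eq)
  moreover have "i div m < n" "j div m < n" using ij by (auto simp: less_mult_imp_div_less)
  ultimately show "kronecker (1\<^sub>m n) (1\<^sub>m m) $$ (i, j) = 1\<^sub>m (n * m) $$ (i, j)"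
    using ij m by (auto simp: index_kronecker[of _ n _ m])
qed (auto simp: kronecker_def)

lemma mat_trace_kronecker:
  assumes A: "A \<in> carrier_mat n n" and B: "B \<in> carrier_mat m m"
  shows "mat_trace (kronecker A B) = mat_trace A * mat_trace B"
proof (cases "m = 0")
  case True
  then show ?thesis using A B by (simp add: mat_trace_def kronecker_def)
next
  case False
  have "mat_trace (kronecker A B) = (\<Sum>l<n * m. A $$ (l div m, l div m) * B $$ (l mod m, l mod m))"
    unfolding mat_trace_eq[OF kronecker_carrier[OF A B]]
    by (intro sum.cong refl) (simp add: index_kronecker[OF A B])
  also have "\<dots> = (\<Sum>a<n. \<Sum>b<m. A $$ (a, a) * B $$ (b, b))" using False by (intro sum_div_mod) simp
  finally show ?thesis unfolding mat_trace_eq[OF A] mat_trace_eq[OF B] by (simp add: sum_product)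
qed

context group
begin

lemma is_rep_tensor:
  assumes V: "is_rep G V" and R: "is_rep G R"
  shows "is_rep G (tensor_rep V R)"
  unfolding is_rep_iff tensor_rep_def fst_conv snd_conv
  using rep_carrier[OF V] rep_carrier[OF R]
  by (auto simp: kronecker_carrier rep_mult[OF V] rep_mult[OF R] rep_one[OF V] rep_one[OF R]
      kronecker_one kronecker_mult[of _ "fst V" _ "fst R"])

lemma chr_tensor:
  assumes V: "is_rep G V" and R: "is_rep G R" and g: "g \<in> carrier G"
  shows "chr (tensor_rep V R) g = chr V g * chr R g"
  unfolding chr_def tensor_rep_def snd_conv
  by (rule mat_trace_kronecker[OF rep_carrier[OF V g] rep_carrier[OF R g]])

end

section \<open>The action on isomorphism classes\<close>

text \<open>Identities between classes, such as the laws of the action, are checked on characters,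
  where the arbitrary choice of representatives disappears.\<close>

lemma (in fin_group) irr_classes_eqI:
  assumes C: "C \<in> irr_classes K" and D: "D \<in> irr_classes K"
    and eq: "\<And>g. g \<in> carrier K \<Longrightarrow> chr (class_rep C) g = chr (class_rep D) g"
  shows "C = D"
  using rep_iso_if_chr_eq[OF irreducible_is_rep[OF irreducible_class_rep[OF C]] irreducible_class_rep[OF D] eq]
    rep_iso_class_rep_iff[OF C D] by blast

lemma (in group) chr_class_rep_irr_class:
  assumes "irreducible_rep G R" "g \<in> carrier G"
  shows "chr (class_rep (irr_class G R)) g = chr R g"
  using chr_iso[OF irreducible_is_rep[OF assms(1)] irreducible_is_rep[OF class_rep_irr_class(1)[OF assms(1)]]
      class_rep_irr_class(2)[OF assms(1)] assms(2)] by simp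

context bicharacter_quotient
begin

sublocale H: fin_group H
  by (rule fin_group_H)

definition act :: "'a set \<Rightarrow> 'a rep set \<Rightarrow> 'a rep set" where
  "act x C = irr_class G (twist x (class_rep C))"

text \<open>Restriction keeps the pair of dimension and map unchanged; only the group over which it
  is read becomes smaller.\<close>

definition proj :: "'a rep set \<Rightarrow> 'a rep set" where
  "proj C = irr_class H (class_rep C)"

lemma act_closed: "x \<in> carrier Q \<Longrightarrow> C \<in> irr_classes G \<Longrightarrow> act x C \<in> irr_classes G"
  unfolding act_def by (intro irr_class_in_classes irreducible_twist irreducible_class_rep)

lemma proj_closed: "C \<in> irr_classes G \<Longrightarrow> proj C \<in> irr_classes H"
  unfolding proj_def by (intro H.irr_class_in_classes irreducible_restrict irreducible_class_rep)

lemma chr_act: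
  assumes "x \<in> carrier Q" "C \<in> irr_classes G" "g \<in> carrier G"
  shows "chr (class_rep (act x C)) g = b x (L #> g) * chr (class_rep C) g"
proof -
  have irr: "irreducible_rep G (class_rep C)" using assms by (intro irreducible_class_rep)
  show ?thesis
    unfolding act_def chr_class_rep_irr_class[OF irreducible_twist[OF irr assms(1)] assms(3)]
    by (rule chr_twist[OF irreducible_is_rep[OF irr] assms(3)])
qed

lemma chr_act_L:
  assumes "x \<in> carrier Q" "C \<in> irr_classes G" "g \<in> L"
  shows "chr (class_rep (act x C)) g = chr (class_rep C) g"
  using chr_act[OF assms(1,2), of g] assms(1,3) coset_eq_L_iff[of g] b_one_right subset by auto

lemma chr_proj: "C \<in> irr_classes G \<Longrightarrow> g \<in> L \<Longrightarrow> chr (class_rep (proj C)) g = chr (class_rep C) g"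
  unfolding proj_def by (intro H.chr_class_rep_irr_class irreducible_restrict irreducible_class_rep) auto

lemma proj_eqI:
  assumes "C \<in> irr_classes G" "E \<in> irr_classes H"
    and "\<And>g. g \<in> L \<Longrightarrow> chr (class_rep C) g = chr (class_rep E) g"
  shows "proj C = E"
  by (rule H.irr_classes_eqI) (use assms in \<open>auto simp: proj_closed chr_proj\<close>)

lemma act_one: "C \<in> irr_classes G \<Longrightarrow> act L C = C"
  by (rule irr_classes_eqI) (auto simp: act_closed L_in_Q chr_act b_one_left coset_carrier)

lemma act_mult:
  assumes "x \<in> carrier Q" "y \<in> carrier Q" "C \<in> irr_classes G"
  shows "act (x \<otimes>\<^bsub>Q\<^esub> y) C = act x (act y C)"
proof (rule irr_classes_eqI)
  have xy: "x \<otimes>\<^bsub>Q\<^esub> y \<in> carrier Q"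
    by (rule monoid.m_closed[OF group.is_monoid[OF group_Q] assms(1,2)])
  show "act (x \<otimes>\<^bsub>Q\<^esub> y) C \<in> irr_classes G" by (rule act_closed[OF xy assms(3)])
  show "act x (act y C) \<in> irr_classes G" by (intro act_closed assms)
  fix g assume "g \<in> carrier G"
  then show "chr (class_rep (act (x \<otimes>\<^bsub>Q\<^esub> y) C)) g = chr (class_rep (act x (act y C))) g"
    using assms xy
    by (simp add: chr_act act_closed b_mult_left coset_carrier del: mult_FactGroup)
qed

lemma proj_act: "x \<in> carrier Q \<Longrightarrow> C \<in> irr_classes G \<Longrightarrow> proj (act x C) = proj C"
  by (rule proj_eqI) (simp_all add: act_closed proj_closed chr_act_L chr_proj)

lemma act_transitive:
  assumes C: "C \<in> irr_classes G" and D: "D \<in> irr_classes G" and eq: "proj C = proj D"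
  shows "\<exists>x\<in>carrier Q. C = act x D"
proof -
  have irr: "irreducible_rep G (class_rep C)" "irreducible_rep G (class_rep D)"
    using C D by (simp_all add: irreducible_class_rep)
  have "rep_iso H (class_rep C) (class_rep D)"
    using eq H.irr_class_eq_iff[OF irreducible_restrict[OF irr(1)] irreducible_restrict[OF irr(2)]]
    by (simp add: proj_def)
  then obtain x where x: "x \<in> carrier Q" "rep_iso G (class_rep C) (twist x (class_rep D))"
    using twist_transitive[OF irr] by blast
  then have "irr_class G (class_rep C) = act x D"
    unfolding act_def using irr_class_eq_iff[OF irr(1) irreducible_twist[OF irr(2)]] by blast
  then show ?thesis using x irr_class_class_rep[OF C] by auto
qed

lemma act_free:
  assumes x: "x \<in> carrier Q" and C: "C \<in> irr_classes G" and eq: "act x C = C"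
  shows "x = L"
proof (rule twist_free[OF irreducible_class_rep[OF C] x])
  have irr: "irreducible_rep G (class_rep C)" using C by (rule irreducible_class_rep)
  show "rep_iso G (class_rep C) (twist x (class_rep C))"
    using eq irr_class_class_rep[OF C] irr_class_eq_iff[OF irr irreducible_twist[OF irr x]]
    unfolding act_def by simp
qed

text \<open>Extendibility in terms of classes: it makes every fibre nonempty.\<close>

lemma proj_surj:
  assumes E: "E \<in> irr_classes H"
  shows "\<exists>C\<in>irr_classes G. proj C = E"
proof -
  obtain R where R: "irreducible_rep G R" and eq: "\<And>g. g \<in> L \<Longrightarrow> chr R g = chr (class_rep E) g"
    using extends[OF H.irreducible_class_rep[OF E]] by blast
  have C: "irr_class G R \<in> irr_classes G" using R by (rule irr_class_in_classes)
  have "proj (irr_class G R) = E"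
    by (rule proj_eqI[OF C E]) (use R eq subset in \<open>auto simp: chr_class_rep_irr_class\<close>)
  then show ?thesis using C by blast
qed

text \<open>In the pairing the twist of \<open>C\<close> contributes \<open>b x\<close> at the coset
  of \<open>g\<close> and the twist of \<open>D\<close> contributes it at the coset of
  \<open>inv g\<close>; the two factors cancel.\<close>

lemma irr_mult_act:
  assumes V: "is_rep G V" and C: "C \<in> irr_classes G" and D: "D \<in> irr_classes G" and x: "x \<in> carrier Q"
  shows "irr_mult G (tensor_rep V (class_rep (act x C))) (act x D) = irr_mult G (tensor_rep V (class_rep C)) D"
proof -
  have rep: "is_rep G (class_rep C)" "is_rep G (class_rep (act x C))"
    using act_closed C x by (auto intro!: irreducible_is_rep irreducible_class_rep)
  have "chr (tensor_rep V (class_rep (act x C))) g * chr (class_rep (act x D)) (inv g) =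
      chr (tensor_rep V (class_rep C)) g * chr (class_rep D) (inv g)" if g: "g \<in> carrier G" for g
  proof -
    have "chr (tensor_rep V (class_rep (act x C))) g * chr (class_rep (act x D)) (inv g) =
        (b x (L #> inv g) * b x (L #> g)) * (chr V g * chr (class_rep C) g * chr (class_rep D) (inv g))"
      using g x C D by (simp add: chr_tensor[OF V] rep chr_act mult_ac)
    then show ?thesis using b_inv[OF x g] g by (simp add: chr_tensor[OF V] rep)
  qed
  then have "char_ip G (chr (tensor_rep V (class_rep (act x C)))) (chr (class_rep (act x D))) =
      char_ip G (chr (tensor_rep V (class_rep C))) (chr (class_rep D))"
    unfolding char_ip_def by (intro arg_cong[of _ _ "\<lambda>s. s / _"] sum.cong refl)
  then have "of_nat (irr_mult G (tensor_rep V (class_rep (act x C))) (act x D)) =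
      (of_nat (irr_mult G (tensor_rep V (class_rep C)) D) :: complex)"
    using C D x rep V by (simp add: of_nat_irr_mult is_rep_tensor act_closed)
  then show ?thesis by simp
qed

text \<open>Frobenius reciprocity applied to \<open>V \<otimes> C\<close>, written with characters.
  It counts the arrows from one vertex into a whole fibre and so matches them in number with the
  arrows downstairs.\<close>

lemma sum_irr_mult_act:
  assumes V: "is_rep G V" and C: "C \<in> irr_classes G" and D: "D \<in> irr_classes G"
  shows "(\<Sum>x\<in>carrier Q. irr_mult G (tensor_rep V (class_rep C)) (act x D)) =
    irr_mult H (tensor_rep V (class_rep (proj C))) (proj D)"
proof -
  have irr: "irreducible_rep G (class_rep C)" "irreducible_rep G (class_rep D)"
    using C D by (simp_all add: irreducible_class_rep)
  note rep = irreducible_is_rep[OF irr(1)] irreducible_is_rep[OF irr(2)]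
  have repP: "is_rep H (class_rep (proj C))"
    using proj_closed[OF C] by (intro irreducible_is_rep H.irreducible_class_rep)
  have "of_nat (\<Sum>x\<in>carrier Q. irr_mult G (tensor_rep V (class_rep C)) (act x D)) =
      (\<Sum>x\<in>carrier Q. char_ip G (chr (tensor_rep V (class_rep C))) (chr (class_rep (act x D))))"
    using D by (simp add: of_nat_irr_mult is_rep_tensor[OF V rep(1)] act_closed)
  also have "\<dots> = (\<Sum>x\<in>carrier Q. char_ip G (chr (tensor_rep V (class_rep C))) (chr (twist x (class_rep D))))"
    using D by (intro sum.cong refl char_ip_cong) (simp_all add: chr_act chr_twist[OF rep(2)])
  also have "\<dots> = char_ip H (chr (tensor_rep V (class_rep C))) (chr (class_rep D))"
    by (rule sum_char_ip_twist[OF rep(2)])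
  also have "\<dots> = char_ip H (chr (tensor_rep V (class_rep (proj C)))) (chr (class_rep (proj D)))"
    using C D subset
    by (intro H.char_ip_cong)
      (auto simp: chr_tensor[OF V rep(1)] H.chr_tensor[OF is_rep_H[OF V] repP] chr_proj)
  also have "\<dots> = of_nat (irr_mult H (tensor_rep V (class_rep (proj C))) (proj D))"
    using proj_closed[OF D] by (simp add: H.of_nat_irr_mult H.is_rep_tensor[OF is_rep_H[OF V] repP])
  finally show ?thesis using of_nat_eq_iff by blast
qed

end

text \<open>For a generator \<open>u\<close> of order \<open>n\<close>, the pairing of
  \<open>u [^] i\<close> with \<open>u [^] j\<close> is the root of unity
  \<open>cis (2 * pi * i * j / n)\<close>.\<close>

lemma (in group) cyclic_bicharacter:
  assumes fin: "finite (carrier G)" and cyc: "cyclic_group G"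
  shows "\<exists>b :: 'a \<Rightarrow> 'a \<Rightarrow> complex.
    (\<forall>x\<in>carrier G. \<forall>y\<in>carrier G. \<forall>z\<in>carrier G. b (x \<otimes> y) z = b x z * b y z \<and> b x (y \<otimes> z) = b x y * b x z) \<and>
    (\<forall>x\<in>carrier G. \<forall>y\<in>carrier G. b x y \<noteq> 0) \<and>
    (\<forall>z\<in>carrier G. (\<Sum>x\<in>carrier G. b x z) = (if z = \<one> then of_nat (card (carrier G)) else 0))"
proof -
  obtain u where u: "u \<in> carrier G" and gen: "carrier G = range (\<lambda>i::int. u [^] i)"
    using cyc cyclic_group by blast
  define n where "n = ord u"
  have n: "n > 0" using ord_ge_1[OF fin u] by (simp add: n_def)
  have id: "u [^] (i::int) = \<one> \<longleftrightarrow> int n dvd i" for i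
    unfolding n_def by (rule int_pow_eq_id[OF u])
  define e where "e i = cis (2 * pi * of_int i / of_nat n)" for i :: int
  have e_add: "e (i + j) = e i * e j" for i j
    by (simp add: e_def cis_mult add_divide_distrib distrib_left)
  have e_nz: "e i \<noteq> 0" for i by (simp add: e_def)
  have e_1: "e i = 1 \<longleftrightarrow> int n dvd i" for i
  proof
    assume "int n dvd i"
    then obtain k where "i = int n * k" by (elim dvdE)
    then have "2 * pi * of_int i / of_nat n = 2 * pi * of_int k" using n by simp
    then have "e i = cis (2 * pi * of_int k)" unfolding e_def by simp
    also have "\<dots> = 1" by (rule cis_multiple_2pi) simp
    finally show "e i = 1" .
  next
    assume "e i = 1"
    then have "cos (2 * pi * of_int i / of_nat n) = 1" by (simp add: e_def complex_eq_iff)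
    then obtain k :: int where "2 * pi * of_int i / of_nat n = of_int k * 2 * pi"
      using cos_one_2pi_int by auto
    then have "real_of_int i = real_of_int (int n * k)" using n by (simp add: field_simps)
    then have "i = int n * k" using of_int_eq_iff by blast
    then show "int n dvd i" by simp
  qed
  have e_mod: "e (i * k) = e (j * k)" if "int n dvd i - j" for i j k
  proof -
    have "e ((i - j) * k) = 1" using that by (simp add: e_1)
    then have "e ((i - j) * k + j * k) = e (j * k)" unfolding e_add by simp
    then show ?thesis by (simp add: algebra_simps)
  qed
  \<comment> \<open>An arbitrary exponent, determined only modulo \<open>n\<close>; by
    \<open>e_mod\<close> the pairing does not depend on the choice.\<close>
  define dlog where "dlog x = (SOME i::int. u [^] i = x)" for x
  have dlog: "u [^] dlog x = x" if "x \<in> carrier G" for x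
    unfolding dlog_def by (rule someI_ex) (use that gen in auto)
  have dlog_dvd: "int n dvd dlog (u [^] i) - i" for i :: int
  proof -
    have "u [^] dlog (u [^] i) = u [^] i" using u by (intro dlog) simp
    then have "u [^] (dlog (u [^] i) - i) = \<one>" using u by (simp add: int_pow_diff)
    then show ?thesis by (simp add: id)
  qed
  define b where "b x y = e (dlog x * dlog y)" for x y
  have b: "b (u [^] i) (u [^] j) = e (i * j)" for i j :: int
    unfolding b_def using e_mod[OF dlog_dvd[of i], of "dlog (u [^] j)"] e_mod[OF dlog_dvd[of j], of i]
    by (simp add: mult.commute)
  have l: "b (x \<otimes> y) z = b x z * b y z \<and> b x (y \<otimes> z) = b x y * b x z"
    if xyz: "x \<in> carrier G" "y \<in> carrier G" "z \<in> carrier G" for x y z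
  proof -
    obtain i j k :: int where ijk: "x = u [^] i" "y = u [^] j" "z = u [^] k" using xyz gen by blast
    have "x \<otimes> y = u [^] (i + j)" "y \<otimes> z = u [^] (j + k)" using u ijk by (simp_all add: int_pow_mult)
    then show ?thesis using ijk by (simp add: b e_add distrib_left distrib_right)
  qed
  have orth: "(\<Sum>x\<in>carrier G. b x z) = (if z = \<one> then of_nat (card (carrier G)) else 0)"
    if z: "z \<in> carrier G" for z
  proof -
    obtain k :: int where k: "z = u [^] k" using z gen by blast
    \<comment> \<open>Translation by the generator permutes the group and multiplies the sum by
      \<open>b u z\<close>. This factor differs from 1 unless \<open>z\<close> is the unit, so the
      sum vanishes.\<close>
    have "(\<Sum>x\<in>carrier G. b x z) = (\<Sum>x\<in>carrier G. b (u \<otimes> x) z)"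
      by (rule sum.reindex_bij_betw[OF bij_betw_left_mult[OF u], symmetric])
    also have "\<dots> = b u z * (\<Sum>x\<in>carrier G. b x z)"
      using l u z by (simp add: sum_distrib_left)
    also have "b u z = e k" using b[of 1 k] u k by simp
    finally have s: "(\<Sum>x\<in>carrier G. b x z) = e k * (\<Sum>x\<in>carrier G. b x z)" .
    show ?thesis
    proof (cases "z = \<one>")
      case True
      have "b x \<one> = 1" if "x \<in> carrier G" for x
        using l[OF that one_closed one_closed] e_nz by (simp add: b_def)
      then show ?thesis using True by simp
    next
      case False
      then have "e k \<noteq> 1" using k id e_1 by simp
      then have "(\<Sum>x\<in>carrier G. b x z) = 0" using s by (simp add: mult_cancel_right1)
      then show ?thesis using False by simp
    qed
  qed
  show ?thesis using l orth e_nz by (intro exI[of _ b]) (auto simp: b_def)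
qed

section \<open>Coverings of quivers given by multiplicities\<close>

text \<open>The covering argument uses only a vertex set and a multiplicity function. The format
  copies \<open>mckay_quiver\<close>, so that the latter is an instance by unfolding.\<close>

definition mult_quiver :: "'v set \<Rightarrow> ('v \<Rightarrow> 'v \<Rightarrow> nat) \<Rightarrow> ('v, 'v \<times> 'v \<times> nat) pre_digraph" where
  "mult_quiver V a = \<lparr>verts = V, arcs = {(C, D, k). C \<in> V \<and> D \<in> V \<and> k < a C D},
     tail = (\<lambda>(C, D, k). C), head = (\<lambda>(C, D, k). D)\<rparr>"

text \<open>Actions take values in \<open>Bij E\<close>, whose elements are extensional functions;
  hence the restriction. The inverse element supplies the inverse bijection.\<close>

lemma group_action_restrictI:
  assumes "group \<Gamma>"
    and closed: "\<And>x e. x \<in> carrier \<Gamma> \<Longrightarrow> e \<in> E \<Longrightarrow> f x e \<in> E"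
    and one: "\<And>e. e \<in> E \<Longrightarrow> f \<one>\<^bsub>\<Gamma>\<^esub> e = e"
    and mult: "\<And>x y e. x \<in> carrier \<Gamma> \<Longrightarrow> y \<in> carrier \<Gamma> \<Longrightarrow> e \<in> E \<Longrightarrow> f (x \<otimes>\<^bsub>\<Gamma>\<^esub> y) e = f x (f y e)"
  shows "group_action \<Gamma> E (\<lambda>x. restrict (f x) E)"
proof -
  interpret group \<Gamma> by fact
  have bij: "restrict (f x) E \<in> Bij E" if x: "x \<in> carrier \<Gamma>" for x
  proof -
    have "f x (f (m_inv \<Gamma> x) e) = e" "f (m_inv \<Gamma> x) (f x e) = e" if "e \<in> E" for e
      using that x one by (simp_all flip: mult)
    then have "bij_betw (f x) E E"
      using x closed by (intro bij_betw_byWitness[of _ "f (m_inv \<Gamma> x)"]) auto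
    then show ?thesis unfolding Bij_def by (auto cong: bij_betw_cong)
  qed
  have "restrict (f (x \<otimes>\<^bsub>\<Gamma>\<^esub> y)) E = compose E (restrict (f x) E) (restrict (f y) E)"
    if "x \<in> carrier \<Gamma>" "y \<in> carrier \<Gamma>" for x y
    using that closed mult by (intro ext) (auto simp: compose_def)
  then have "(\<lambda>x. restrict (f x) E) \<in> hom \<Gamma> (BijGroup E)"
    using bij by (auto simp: hom_def BijGroup_def)
  then show ?thesis
    by (intro group_action.intro group_hom.intro group_hom_axioms.intro group_BijGroup)
      (simp_all add: assms(1))
qed

text \<open>Arrows are sent down by moving their tail to a chosen point of its fibre. The
  arrows that leave this point and end in a given fibre are matched with the arrows downstairs by an
  arbitrary bijection.\<close>

theorem mult_quiver_covering:
  fixes \<Gamma> :: "('c, 'd) monoid_scheme" and act :: "'c \<Rightarrow> 'v \<Rightarrow> 'v" and p :: "'v \<Rightarrow> 'w"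
  assumes \<Gamma>: "group \<Gamma>" and fin: "finite (carrier \<Gamma>)"
    and act: "\<And>x C. x \<in> carrier \<Gamma> \<Longrightarrow> C \<in> V \<Longrightarrow> act x C \<in> V"
    and act_one: "\<And>C. C \<in> V \<Longrightarrow> act \<one>\<^bsub>\<Gamma>\<^esub> C = C"
    and act_mult: "\<And>x y C. x \<in> carrier \<Gamma> \<Longrightarrow> y \<in> carrier \<Gamma> \<Longrightarrow> C \<in> V \<Longrightarrow> act (x \<otimes>\<^bsub>\<Gamma>\<^esub> y) C = act x (act y C)"
    and p: "\<And>C. C \<in> V \<Longrightarrow> p C \<in> V'"
    and p_act: "\<And>x C. x \<in> carrier \<Gamma> \<Longrightarrow> C \<in> V \<Longrightarrow> p (act x C) = p C"
    and trans: "\<And>C D. C \<in> V \<Longrightarrow> D \<in> V \<Longrightarrow> p C = p D \<Longrightarrow> \<exists>x\<in>carrier \<Gamma>. C = act x D"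
    and free: "\<And>x C. x \<in> carrier \<Gamma> \<Longrightarrow> C \<in> V \<Longrightarrow> act x C = C \<Longrightarrow> x = \<one>\<^bsub>\<Gamma>\<^esub>"
    and surj: "\<And>c. c \<in> V' \<Longrightarrow> \<exists>C\<in>V. p C = c"
    and a_act: "\<And>x C D. x \<in> carrier \<Gamma> \<Longrightarrow> C \<in> V \<Longrightarrow> D \<in> V \<Longrightarrow> a (act x C) (act x D) = a C D"
    and a_sum: "\<And>C D. C \<in> V \<Longrightarrow> D \<in> V \<Longrightarrow> (\<Sum>x\<in>carrier \<Gamma>. a C (act x D)) = a' (p C) (p D)"
  shows "\<exists>\<pi>v \<pi>a. regular_covering_map \<Gamma> (mult_quiver V a) (mult_quiver V' a') \<pi>v \<pi>a"
proof -
  interpret \<Gamma>: group \<Gamma> by fact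
  let ?inv = "m_inv \<Gamma>"
  have act_inv: "act (?inv x) (act x C) = C" "act x (act (?inv x) C) = C"
    if "x \<in> carrier \<Gamma>" "C \<in> V" for x C
    using that by (simp_all add: act_one flip: act_mult)
  have act_inj: "x = y" if "act x C = act y C" "x \<in> carrier \<Gamma>" "y \<in> carrier \<Gamma>" "C \<in> V" for x y C
  proof -
    have "act (?inv y \<otimes>\<^bsub>\<Gamma>\<^esub> x) C = C" using that by (simp add: act_mult act_inv)
    then have "?inv y \<otimes>\<^bsub>\<Gamma>\<^esub> x = \<one>\<^bsub>\<Gamma>\<^esub>" using that by (intro free) auto
    then have "x \<otimes>\<^bsub>\<Gamma>\<^esub> ?inv y = \<one>\<^bsub>\<Gamma>\<^esub>" by (rule \<Gamma>.inv_comm) (use that in auto)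
    then have "?inv (?inv y) = x" by (rule \<Gamma>.inv_equality) (use that in auto)
    then show ?thesis using that by simp
  qed
  obtain s where s: "\<And>c. c \<in> V' \<Longrightarrow> s c \<in> V" "\<And>c. c \<in> V' \<Longrightarrow> p (s c) = c"
    using surj by metis
  have "\<forall>C\<in>V. \<exists>x\<in>carrier \<Gamma>. C = act x (s (p C))" using trans s p by metis
  \<comment> \<open>\<open>s c\<close> is the base point of the fibre over \<open>c\<close>, and
    \<open>t C\<close> is the group element that carries the base point to \<open>C\<close>, unique
    by freeness.\<close>
  then obtain t where t: "\<And>C. C \<in> V \<Longrightarrow> t C \<in> carrier \<Gamma>" "\<And>C. C \<in> V \<Longrightarrow> act (t C) (s (p C)) = C"
    by metis
  have t_eq: "t C = x" if "C \<in> V" "x \<in> carrier \<Gamma>" "C = act x (s (p C))" for C x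
    by (rule act_inj[of _ "s (p C)"]) (use that t s p in auto)
  have t_act: "t (act x C) = x \<otimes>\<^bsub>\<Gamma>\<^esub> t C" if x: "x \<in> carrier \<Gamma>" and C: "C \<in> V" for x C
  proof (rule t_eq)
    show "act x C = act (x \<otimes>\<^bsub>\<Gamma>\<^esub> t C) (s (p (act x C)))"
      using t[OF C] s p[OF C] x C by (simp add: act_mult p_act)
  qed (use x C t act in auto)
  have s_eq: "act (?inv (t C)) C = s (p C)" if C: "C \<in> V" for C
    using act_inv(1)[OF t(1)[OF C] s(1)[OF p[OF C]]] t(2)[OF C] by simp
  \<comment> \<open>The arrows that start at the base point over \<open>c\<close> and end in the
    fibre over \<open>d\<close>, recorded by head and number.\<close>
  define Y where "Y c d = {(D, k). D \<in> V \<and> p D = d \<and> k < a (s c) D}" for c d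
  have "\<exists>f. bij_betw f (Y c d) {..<a' c d}" if c: "c \<in> V'" and d: "d \<in> V'" for c d
  proof -
    let ?Z = "SIGMA x:carrier \<Gamma>. {..<a (s c) (act x (s d))}"
    \<comment> \<open>Each point of the fibre over \<open>d\<close> is \<open>act x (s d)\<close>
      for exactly one \<open>x\<close>, so \<open>Y c d\<close> has as many elements as the sum in
      \<open>a_sum\<close>, which is \<open>a' c d\<close>.\<close>
    have "Y c d = (\<lambda>(x, k). (act x (s d), k)) ` ?Z"
    proof (intro equalityI subsetI)
      fix e assume "e \<in> Y c d"
      then obtain D k where e: "e = (D, k)" "D \<in> V" "p D = d" "k < a (s c) D" by (auto simp: Y_def)
      have "e = (\<lambda>(x, k). (act x (s d), k)) (t D, k)" using t(2)[OF e(2)] e by simp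
      moreover have "(t D, k) \<in> ?Z" using t[OF e(2)] e by auto
      ultimately show "e \<in> (\<lambda>(x, k). (act x (s d), k)) ` ?Z" by (rule image_eqI)
    qed (use s[OF d] act p_act in \<open>auto simp: Y_def\<close>)
    moreover have "inj_on (\<lambda>(x, k). (act x (s d), k)) ?Z"
      using act_inj[OF _ _ _ s(1)[OF d]] by (auto simp: inj_on_def)
    ultimately have "card (Y c d) = card ?Z" and "finite (Y c d)"
      using fin by (simp_all add: card_image)
    moreover have "card ?Z = a' c d"
      using a_sum[OF s(1)[OF c] s(1)[OF d]] s(2)[OF c] s(2)[OF d] fin by (simp add: card_SigmaI)
    ultimately show ?thesis using finite_same_card_bij[of "Y c d" "{..<a' c d}"] by simp
  qed
  then obtain f where f: "\<And>c d. c \<in> V' \<Longrightarrow> d \<in> V' \<Longrightarrow> bij_betw (f c d) (Y c d) {..<a' c d}"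
    by metis
  \<comment> \<open>The head is moved by the same element that takes the tail to its base point. The
    number \<open>k\<close> can be kept because \<open>a_act\<close> makes multiplicities
    invariant.\<close>
  define \<pi>a where "\<pi>a = (\<lambda>(C, D, k). (p C, p D, f (p C) (p D) (act (?inv (t C)) D, k)))"
  define \<phi>a where "\<phi>a x = (\<lambda>(C, D, k). (act x C, act x D, k :: nat))" for x
  let ?Q = "mult_quiver V a" and ?Q' = "mult_quiver V' a'"
  have arcs: "arcs ?Q = {(C, D, k). C \<in> V \<and> D \<in> V \<and> k < a C D}"
    "arcs ?Q' = {(C, D, k). C \<in> V' \<and> D \<in> V' \<and> k < a' C D}"
    and verts: "verts ?Q = V" "verts ?Q' = V'"
    and ends: "tail ?Q (C, D, k) = C" "head ?Q (C, D, k) = D" "tail ?Q' (C', D', k) = C'" "head ?Q' (C', D', k) = D'"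
    for C D C' D' k by (simp_all add: mult_quiver_def)
  have moved: "(act (?inv (t C)) D, k) \<in> Y (p C) (p D)" if "C \<in> V" "D \<in> V" "k < a C D" for C D k
    using that a_act[of "?inv (t C)" C D] t(1)[of C] s_eq[of C]
    by (auto simp: Y_def act p_act)
  have f_less: "f (p C) (p D) (act (?inv (t C)) D, k) < a' (p C) (p D)"
    if "C \<in> V" "D \<in> V" "k < a C D" for C D k
    using bij_betwE[OF f[OF p p]] moved that by blast
  have f_inj: "e = e'" if "f c d e = f c d e'" "e \<in> Y c d" "e' \<in> Y c d" "c \<in> V'" "d \<in> V'" for c d e e'
    using inj_onD[OF bij_betw_imp_inj_on[OF f]] that by blast
  have f_surj: "\<exists>D k. D \<in> V \<and> p D = d \<and> k < a (s c) D \<and> f c d (D, k) = j"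
    if "c \<in> V'" "d \<in> V'" "j < a' c d" for c d j
  proof -
    have "j \<in> f c d ` Y c d" using bij_betw_imp_surj_on[OF f[OF that(1,2)]] that(3) by simp
    then show ?thesis unfolding Y_def by auto
  qed
  have qm: "quiver_map ?Q ?Q' p \<pi>a"
    unfolding quiver_map_def verts using p f_less by (auto simp: arcs ends \<pi>a_def)
  have \<pi>a_act: "\<pi>a (\<phi>a x e) = \<pi>a e" if x: "x \<in> carrier \<Gamma>" and e: "e \<in> arcs ?Q" for x e
  proof -
    obtain C D k where e: "e = (C, D, k)" "C \<in> V" "D \<in> V" using e unfolding arcs by auto
    \<comment> \<open>By \<open>t_act\<close> the translated tail is brought to the base point by
      the inverse of \<open>x \<otimes> t C\<close>, which first undoes \<open>x\<close>. The
      translated arrow thus yields the same element of \<open>Y\<close>.\<close>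
    have "act (?inv (x \<otimes>\<^bsub>\<Gamma>\<^esub> t C)) (act x D) = act (?inv (t C)) (act (?inv x) (act x D))"
      using x e t(1)[OF e(2)] by (simp add: \<Gamma>.inv_mult_group act_mult act)
    then show ?thesis using x e by (simp add: \<pi>a_def \<phi>a_def p_act t_act act_inv)
  qed
  have ga: "group_action \<Gamma> (verts ?Q) (\<lambda>x. restrict (act x) (verts ?Q))"
    unfolding verts by (intro group_action_restrictI \<Gamma> act act_one act_mult)
  have ga': "group_action \<Gamma> (arcs ?Q) (\<lambda>x. restrict (\<phi>a x) (arcs ?Q))"
    by (rule group_action_restrictI[OF \<Gamma>]) (auto simp: arcs \<phi>a_def act act_one act_mult a_act)
  have qm': "quiver_map ?Q ?Q (restrict (act x) (verts ?Q)) (restrict (\<phi>a x) (arcs ?Q))"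
    if "x \<in> carrier \<Gamma>" for x
    unfolding quiver_map_def verts using that by (auto simp: arcs ends \<phi>a_def act a_act)
  have fibre: "let F = {i \<in> verts ?Q. p i = j} in F \<noteq> {} \<and>
      (\<forall>x\<in>F. \<forall>y\<in>F. \<exists>\<gamma>\<in>carrier \<Gamma>. restrict (act \<gamma>) (verts ?Q) x = y) \<and>
      (\<forall>x\<in>F. stabilizer \<Gamma> (\<lambda>x. restrict (act x) (verts ?Q)) x = {\<one>\<^bsub>\<Gamma>\<^esub>})" if j: "j \<in> verts ?Q'" for j
  proof -
    have "\<exists>\<gamma>\<in>carrier \<Gamma>. act \<gamma> x = y" if "x \<in> V" "y \<in> V" "p x = p y" for x y
      using trans[of y x] that by auto
    moreover have "stabilizer \<Gamma> (\<lambda>x. restrict (act x) V) x = {\<one>\<^bsub>\<Gamma>\<^esub>}" if "x \<in> V" for x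
      using that free act_one by (auto simp: stabilizer_def)
    ultimately show ?thesis using surj[of j] j unfolding verts Let_def by auto
  qed
  have out: "bij_betw \<pi>a (out_arcs ?Q C) (out_arcs ?Q' (p C))" if C: "C \<in> V" for C
    unfolding bij_betw_def
  proof (intro conjI equalityI subsetI inj_onI)
    fix e e' assume "e \<in> out_arcs ?Q C" "e' \<in> out_arcs ?Q C" and eq: "\<pi>a e = \<pi>a e'"
    then obtain D k D' k' where e: "e = (C, D, k)" "D \<in> V" "k < a C D" "e' = (C, D', k')" "D' \<in> V" "k' < a C D'"
      by (auto simp: out_arcs_def arcs ends)
    have pD: "p D = p D'" and eqf: "f (p C) (p D) (act (?inv (t C)) D, k) = f (p C) (p D) (act (?inv (t C)) D', k')"
      using eq unfolding e by (auto simp: \<pi>a_def)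
    have "(act (?inv (t C)) D', k') \<in> Y (p C) (p D)" using moved[OF C e(5,6)] pD by simp
    then have eq': "(act (?inv (t C)) D, k) = (act (?inv (t C)) D', k')"
      using f_inj[OF eqf moved[OF C e(2,3)] _ p[OF C] p[OF e(2)]] by blast
    then have "act (t C) (act (?inv (t C)) D) = act (t C) (act (?inv (t C)) D')" by simp
    then show "e = e'" using eq' e t(1)[OF C] by (simp add: act_inv)
  next
    fix e assume "e \<in> \<pi>a ` out_arcs ?Q C"
    then show "e \<in> out_arcs ?Q' (p C)"
      using f_less p by (auto simp: out_arcs_def arcs ends \<pi>a_def)
  next
    fix e assume "e \<in> out_arcs ?Q' (p C)"
    then obtain d j where e: "e = (p C, d, j)" "d \<in> V'" "j < a' (p C) d"
      by (auto simp: out_arcs_def arcs ends)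
    obtain D k where D: "D \<in> V" "p D = d" "k < a (s (p C)) D" "f (p C) d (D, k) = j"
      using f_surj[OF p[OF C] e(2,3)] by blast
    have "k < a C (act (t C) D)"
      using a_act[OF t(1)[OF C] s(1)[OF p[OF C]] D(1)] t(2)[OF C] D by simp
    then have "(C, act (t C) D, k) \<in> out_arcs ?Q C"
      using C D t(1)[OF C] act by (simp add: out_arcs_def arcs ends)
    moreover have "\<pi>a (C, act (t C) D, k) = e"
      using e D t(1)[OF C] by (simp add: \<pi>a_def p_act act_inv)
    ultimately show "e \<in> \<pi>a ` out_arcs ?Q C" by force
  qed
  have into: "bij_betw \<pi>a (in_arcs ?Q D) (in_arcs ?Q' (p D))" if D: "D \<in> V" for D
    unfolding bij_betw_def
  proof (intro conjI equalityI subsetI inj_onI)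
    fix e e' assume "e \<in> in_arcs ?Q D" "e' \<in> in_arcs ?Q D" and eq: "\<pi>a e = \<pi>a e'"
    then obtain C k C' k' where e: "e = (C, D, k)" "C \<in> V" "k < a C D" "e' = (C', D, k')" "C' \<in> V" "k' < a C' D"
      by (auto simp: in_arcs_def arcs ends)
    have pC: "p C = p C'" and eqf: "f (p C) (p D) (act (?inv (t C)) D, k) = f (p C) (p D) (act (?inv (t C')) D, k')"
      using eq unfolding e by (auto simp: \<pi>a_def)
    have "(act (?inv (t C')) D, k') \<in> Y (p C) (p D)" using moved[OF e(5) D e(6)] pC by simp
    then have eq': "(act (?inv (t C)) D, k) = (act (?inv (t C')) D, k')"
      using f_inj[OF eqf moved[OF e(2) D e(3)] _ p[OF e(2)] p[OF D]] by blast
    \<comment> \<open>Here the head is fixed and the tails vary. Equal moved heads come from the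
      same \<open>D\<close>, so freeness gives equal group elements, and the tails, lying in one
      fibre, coincide.\<close>
    have "?inv (t C) = ?inv (t C')" by (rule act_inj[OF _ _ _ D]) (use eq' e t in auto)
    then have "?inv (?inv (t C)) = ?inv (?inv (t C'))" by simp
    then have "t C = t C'" using t(1)[OF e(2)] t(1)[OF e(5)] by simp
    then have "act (t C) (s (p C)) = act (t C') (s (p C'))" using pC by (simp only:)
    then have "C = C'" by (simp only: t(2)[OF e(2)] t(2)[OF e(5)])
    then show "e = e'" using e eq' by simp
  next
    fix e assume "e \<in> \<pi>a ` in_arcs ?Q D"
    then show "e \<in> in_arcs ?Q' (p D)"
      using f_less p by (auto simp: in_arcs_def arcs ends \<pi>a_def)
  next
    fix e assume "e \<in> in_arcs ?Q' (p D)"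
    then obtain c j where e: "e = (c, p D, j)" "c \<in> V'" "j < a' c (p D)"
      by (auto simp: in_arcs_def arcs ends)
    obtain D' k where D': "D' \<in> V" "p D' = p D" "k < a (s c) D'" "f c (p D) (D', k) = j"
      using f_surj[OF e(2) p[OF D] e(3)] by blast
    \<comment> \<open>The arrow found at the base point ends at \<open>D'\<close>, somewhere in the
      fibre of \<open>D\<close>. The translation that takes \<open>D'\<close> to \<open>D\<close>
      takes its tail to the required \<open>C\<close>, with \<open>t C = x\<close>.\<close>
    obtain x where x: "x \<in> carrier \<Gamma>" "D = act x D'" using trans[OF D D'(1)] D'(2) by auto
    define C where "C = act x (s c)"
    have C: "C \<in> V" "p C = c" using x s[OF e(2)] act p_act by (simp_all add: C_def)
    have tC: "t C = x" by (rule t_eq) (use C x in \<open>simp_all add: C_def\<close>)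
    have "k < a C D" using a_act[OF x(1) s(1)[OF e(2)] D'(1)] D'(3) x(2) by (simp add: C_def)
    then have "(C, D, k) \<in> in_arcs ?Q D" using C D by (simp add: in_arcs_def arcs ends)
    moreover have "\<pi>a (C, D, k) = e"
      using e C D' tC x act_inv(1)[OF x(1) D'(1)] by (simp add: \<pi>a_def)
    ultimately show "e \<in> \<pi>a ` in_arcs ?Q D" by force
  qed
  have "regular_covering_map \<Gamma> ?Q ?Q' p \<pi>a"
    unfolding regular_covering_map_def
  proof (intro conjI ballI exI[of _ "\<lambda>x. restrict (act x) (verts ?Q)"]
      exI[of _ "\<lambda>x. restrict (\<phi>a x) (arcs ?Q)"])
    show "bij_betw \<pi>a (out_arcs ?Q i) (out_arcs ?Q' (p i))"
      "bij_betw \<pi>a (in_arcs ?Q i) (in_arcs ?Q' (p i))" if "i \<in> verts ?Q" for i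
      using that out into by (simp_all add: verts)
  qed (use qm ga ga' qm' fibre \<pi>a_act p_act in \<open>simp_all add: verts\<close>)
  then show ?thesis by blast
qed

section \<open>Application to McKay quivers\<close>

lemma mckay_quiver_eq:
  "mckay_quiver m H = mult_quiver (irr_classes (GL_sub m H))
     (\<lambda>C D. irr_mult (GL_sub m H) (tensor_rep (m, \<lambda>g. g) (class_rep C)) D)"
  by (simp add: mckay_quiver_def mult_quiver_def)

text \<open>Turns extendibility, an equation between restricted functions, into the pointwise form
  used by \<open>bicharacter_quotient\<close>.\<close>

lemma extends_if_extendible:
  assumes ext: "\<forall>\<chi>\<in>irr_chars (G\<lparr>carrier := L\<rparr>). extendible G L \<chi>" and L: "L \<subseteq> carrier G"
    and S: "irreducible_rep (G\<lparr>carrier := L\<rparr>) S"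
  shows "\<exists>R. irreducible_rep G R \<and> (\<forall>g\<in>L. chr R g = chr S g)"
proof -
  have "restrict (chr S) L \<in> irr_chars (G\<lparr>carrier := L\<rparr>)"
    unfolding irr_chars_def by (rule CollectI, rule exI[of _ S]) (simp add: S chr_def[abs_def])
  then obtain R where R: "irreducible_rep G R"
    and eq: "restrict (restrict (chr R) (carrier G)) L = restrict (chr S) L"
    using ext unfolding extendible_def irr_chars_def chr_def[abs_def] by blast
  have "chr R g = chr S g" if "g \<in> L" for g
    using fun_cong[OF eq, of g] that L by (simp add: subsetD)
  then show ?thesis using R by blast
qed

theorem theorem1p3:
  fixes m :: nat and G L :: "complex mat set"
  assumes "m \<ge> 1"
    and "subgroup G (GL m)" and "finite G"
    and "L \<lhd> GL_sub m G"
    and "cyclic_group (GL_sub m G Mod L)"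
    and "\<forall>\<chi>\<in>irr_chars (GL_sub m L). extendible (GL_sub m G) L \<chi>"
  shows "\<exists>\<pi>v \<pi>a. regular_covering_map (GL_sub m G Mod L)
           (mckay_quiver m G) (mckay_quiver m L) \<pi>v \<pi>a"
proof -
  define K where "K = GL_sub m G"
  interpret normal L K unfolding K_def by fact
  have fin: "fin_group K"
    using is_group \<open>finite G\<close> by (auto simp: fin_group_def fin_group_axioms_def K_def)
  have H: "GL_sub m L = K\<lparr>carrier := L\<rparr>" by (simp add: K_def)
  have ext: "\<forall>\<chi>\<in>irr_chars (K\<lparr>carrier := L\<rparr>). extendible K L \<chi>"
    using assms(6) by (simp add: K_def)
  have finQ: "finite (carrier (K Mod L))"
    using \<open>finite G\<close> by (simp add: carrier_FactGroup K_def)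
  \<comment> \<open>Cyclicity of the quotient enters here, through the pairing of the quotient with
    itself.\<close>
  obtain b :: "complex mat set \<Rightarrow> complex mat set \<Rightarrow> complex" where b:
    "(\<forall>x\<in>carrier (K Mod L). \<forall>y\<in>carrier (K Mod L). \<forall>z\<in>carrier (K Mod L).
      b (x \<otimes>\<^bsub>K Mod L\<^esub> y) z = b x z * b y z \<and> b x (y \<otimes>\<^bsub>K Mod L\<^esub> z) = b x y * b x z) \<and>
    (\<forall>x\<in>carrier (K Mod L). \<forall>y\<in>carrier (K Mod L). b x y \<noteq> 0) \<and>
    (\<forall>z\<in>carrier (K Mod L). (\<Sum>x\<in>carrier (K Mod L). b x z) =
      (if z = \<one>\<^bsub>K Mod L\<^esub> then of_nat (card (carrier (K Mod L))) else 0))"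
    using group.cyclic_bicharacter[OF factorgroup_is_group finQ assms(5)[folded K_def]]
    by (elim exE) (rule that)
  interpret B: bicharacter_quotient L K b
  proof (intro bicharacter_quotient.intro bicharacter_quotient_axioms.intro)
    show "fin_group K" by (rule fin)
    show "L \<lhd> K" by (rule normal_axioms)
    show "\<exists>R. irreducible_rep K R \<and> (\<forall>g\<in>L. chr R g = chr S g)"
      if "irreducible_rep (K\<lparr>carrier := L\<rparr>) S" for S
      by (rule extends_if_extendible[OF ext subset that])
  qed (use b in \<open>simp_all del: mult_FactGroup\<close>)
  have V: "is_rep K (m, \<lambda>g. g)"
    using subgroup.subset[OF assms(2)] by (auto simp: is_rep_def hom_def K_def GL_def units_of_def ring_mat_simps)
  have "\<exists>\<pi>v \<pi>a. regular_covering_map (K Mod L)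
    (mult_quiver (irr_classes K) (\<lambda>C D. irr_mult K (tensor_rep (m, \<lambda>g. g) (class_rep C)) D))
    (mult_quiver (irr_classes (K\<lparr>carrier := L\<rparr>))
      (\<lambda>C D. irr_mult (K\<lparr>carrier := L\<rparr>) (tensor_rep (m, \<lambda>g. g) (class_rep C)) D)) \<pi>v \<pi>a"
  proof (rule mult_quiver_covering[where act = B.act and p = B.proj, OF B.group_Q finQ])
    show "x = \<one>\<^bsub>K Mod L\<^esub>" if "x \<in> carrier (K Mod L)" "C \<in> irr_classes K" "B.act x C = C" for x C
      using B.act_free[OF that] by simp
  qed (use V in \<open>simp_all del: mult_FactGroup add: B.act_closed B.act_one B.act_mult B.proj_closed B.proj_act
      B.act_transitive B.proj_surj B.irr_mult_act B.sum_irr_mult_act\<close>)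
  then show ?thesis unfolding mckay_quiver_eq H K_def[symmetric] .
qed

end
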